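(* For every integer $n\geq 1$, the neighborhood complex $\mathcal{N}(SG_{n,2})$ of the stable Kneser graph $SG_{n,2}$ simplicially collapses onto a subcomplex that is (isomorphic to) the boundary complex of a three-dimensional simplicial polytope.
   Context: For a graph $G=(V,E)$, the neighborhood complex $\mathcal{N}(G)$ is the simplicial complex on vertex set $V$ whose faces are the subsets $F\subseteq V$ having a common neighbor, i.e. there is $v\in V$ with $\{u,v\}\in E$ for all $u\in F$. An $n$-subset $\alpha$ of $[2n+2]=\{1,\dots,2n+2\}$ is stable if it contains no pair $\{i,i+1\}$ for $1\le i\le 2n+1$ and does not contain $\{1,2n+2\}$. The stable Kneser graph $SG_{n,2}$ has as vertices the stable $n$-subsets of $[2n+2]$, two being adjacent iff they are disjoint. A simplicial collapse onto a subcomplex is a finite sequence of elementary collapses (removals of a free face together with the unique face properly containing it); in particular the subcomplex is a deformation retract. *)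

theory Defs
  imports "HOL-Analysis.Analysis" "Graph_Theory.Pair_Digraph"
begin

section \<open>Abstract simplicial complexes and collapses\<close>

text \<open>A complex is represented by its set of faces, the empty face included; its vertex
  set is the union of all faces.\<close>

definition abstract_complex :: "'a set set \<Rightarrow> bool" where
  "abstract_complex K \<longleftrightarrow> (\<forall>F\<in>K. finite F \<and> (\<forall>F'\<subseteq>F. F' \<in> K))"

definition complex_iso :: "'a set set \<Rightarrow> 'b set set \<Rightarrow> bool" where
  "complex_iso K L \<longleftrightarrow> (\<exists>f. bij_betw f (\<Union>K) (\<Union>L) \<and> (\<lambda>F. f ` F) ` K = L)"

text \<open>As usual, the empty face is never a free face: a point does not collapse to the void
  complex.\<close>

definition elementary_collapse :: "'a set set \<Rightarrow> 'a set set \<Rightarrow> bool" where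
  "elementary_collapse K L \<longleftrightarrow>
     (\<exists>\<sigma> \<tau>. \<sigma> \<in> K \<and> \<tau> \<in> K \<and> \<sigma> \<noteq> {} \<and> \<sigma> \<subset> \<tau> \<and> (\<forall>\<rho>\<in>K. \<sigma> \<subset> \<rho> \<longrightarrow> \<rho> = \<tau>) \<and>
            L = K - {\<sigma>, \<tau>})"

definition collapses_onto :: "'a set set \<Rightarrow> 'a set set \<Rightarrow> bool" where
  "collapses_onto = elementary_collapse\<^sup>*\<^sup>*"

lemma elementary_collapse_subcomplex:
  assumes "elementary_collapse K L" "abstract_complex K"
  shows "L \<subseteq> K \<and> abstract_complex L"
proof -
  obtain \<sigma> \<tau> where *: "\<sigma> \<subset> \<tau>" "\<forall>\<rho>\<in>K. \<sigma> \<subset> \<rho> \<longrightarrow> \<rho> = \<tau>" "L = K - {\<sigma>, \<tau>}"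
    using assms(1) by (auto simp: elementary_collapse_def)
  have "F' \<in> L" if "F \<in> L" "F' \<subseteq> F" for F F'
  proof -
    have "F \<in> K" "F' \<in> K" "F \<noteq> \<sigma>" "F \<noteq> \<tau>"
      using that assms(2) *(3) by (auto simp: abstract_complex_def)
    moreover have "F' \<noteq> \<sigma>" using calculation that(2) *(2) by blast
    moreover have "F' \<noteq> \<tau>" using calculation that(2) *(1,2) by blast
    ultimately show ?thesis using *(3) by simp
  qed
  moreover have "L \<subseteq> K"
    using *(3) by blast
  moreover have "finite F" if "F \<in> L" for F
    using that \<open>L \<subseteq> K\<close> assms(2) unfolding abstract_complex_def by (meson subsetD)
  ultimately show ?thesis
    unfolding abstract_complex_def by (intro conjI ballI allI impI)
qed

lemma collapses_onto_subcomplex: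
  assumes "collapses_onto K L" "abstract_complex K"
  shows "L \<subseteq> K \<and> abstract_complex L"
  using assms(1) unfolding collapses_onto_def
proof (induction rule: rtranclp_induct)
  case base
  then show ?case using assms(2) by simp
next
  case (step L M)
  then show ?case using elementary_collapse_subcomplex[of L M] by blast
qed

section \<open>Neighborhood complexes and stable Kneser graphs\<close>

text \<open>Undirected simple graphs are symmetric loop-free digraphs (locale \<^locale>\<open>pair_graph\<close>):
  an edge \<open>{u, v}\<close> is the pair of arcs \<open>(u, v)\<close>, \<open>(v, u)\<close>.\<close>

definition neighborhood_complex :: "'a pair_pre_digraph \<Rightarrow> 'a set set" where
  "neighborhood_complex G =
     {F. F \<subseteq> pverts G \<and> (\<exists>v\<in>pverts G. \<forall>u\<in>F. (u, v) \<in> parcs G)}"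

lemma abstract_complex_neighborhood_complex:
  assumes "finite (pverts G)"
  shows "abstract_complex (neighborhood_complex G)"
  unfolding abstract_complex_def
proof (intro ballI conjI allI impI)
  fix F assume F: "F \<in> neighborhood_complex G"
  then show "finite F"
    using assms finite_subset by (auto simp: neighborhood_complex_def)
  fix F' assume "F' \<subseteq> F"
  with F show "F' \<in> neighborhood_complex G"
    by (auto simp: neighborhood_complex_def)
qed

definition stable :: "nat \<Rightarrow> nat set \<Rightarrow> bool" where
  "stable m \<alpha> \<longleftrightarrow>
     \<alpha> \<subseteq> {1..m} \<and> (\<forall>i. 1 \<le> i \<and> i < m \<longrightarrow> \<not> {i, i + 1} \<subseteq> \<alpha>) \<and> \<not> {1, m} \<subseteq> \<alpha>"

definition stable_kneser_graph :: "nat \<Rightarrow> nat \<Rightarrow> nat set pair_pre_digraph" where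
  "stable_kneser_graph n k =
     (let V = {\<alpha>. stable (2 * n + k) \<alpha> \<and> card \<alpha> = n}
      in \<lparr> pverts = V, parcs = {(\<alpha>, \<beta>). \<alpha> \<in> V \<and> \<beta> \<in> V \<and> \<alpha> \<inter> \<beta> = {}} \<rparr>)"

lemma pair_graph_stable_kneser_graph:
  assumes "n \<ge> 1"
  shows "pair_graph (stable_kneser_graph n k)"
proof -
  let ?G = "stable_kneser_graph n k"
  have "pverts ?G \<subseteq> Pow {1..2 * n + k}"
    by (auto simp: stable_kneser_graph_def stable_def)
  then have fin: "finite (pverts ?G)"
    using finite_subset by blast
  have arcs: "parcs ?G \<subseteq> pverts ?G \<times> pverts ?G"
    by (auto simp: stable_kneser_graph_def)
  have sym: "symmetric (with_proj ?G)"
    by (auto simp: symmetric_def arcs_ends_def arc_to_ends_def sym_def stable_kneser_graph_def)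
  have loop: "fst e \<noteq> snd e" if "e \<in> parcs ?G" for e
  proof
    assume "fst e = snd e"
    moreover have "fst e \<inter> snd e = {}" "card (fst e) = n"
      using that by (cases e; simp add: stable_kneser_graph_def)+
    ultimately show False using assms by simp
  qed
  show ?thesis
  proof unfold_locales
    show "finite (parcs ?G)"
      using fin arcs by (meson finite_SigmaI finite_subset)
  qed (use fin arcs sym loop in \<open>(fastforce | assumption)+\<close>)
qed

section \<open>Boundary complexes of simplicial polytopes\<close>

definition simplicial_polytope :: "'a::euclidean_space set \<Rightarrow> bool" where
  "simplicial_polytope P \<longleftrightarrow>
     polytope P \<and> (\<forall>F. F face_of P \<and> F \<noteq> P \<longrightarrow> (\<exists>d. d simplex F))"

text \<open>The boundary complex as an abstract complex: the vertex sets of the proper faces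
  (the empty one included).\<close>

definition boundary_complex :: "'a::euclidean_space set \<Rightarrow> 'a set set" where
  "boundary_complex P = {{v. v extreme_point_of F} | F. F face_of P \<and> F \<noteq> P}"

end

theory Submission
  imports Defs
begin

text \<open>Write \<open>N = n + 1\<close>. A stable \<open>n\<close>-subset of the \<open>2 * N\<close>-cycle leaves two of its edges uncovered, one
  of each parity, so the vertices of the neighborhood complex form an \<open>N\<close> by \<open>N\<close> grid: \<open>N\<close> rows, each
  a cycle of length \<open>N\<close>, consecutive rows being shifted by half a step. The maximal faces are the
  diamonds between three consecutive rows (full tetrahedra), and the cones from the vertices next to
  an end row over the full simplex on that end row. Cutting every diamond along its horizontal
  diagonal, thinning every cone to a triangle and the end simplices to fans leaves a stack of
  antiprisms whose two end polygons are triangulated.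

  To see that this sphere is polytopal, put the rows as regular \<open>N\<close>-gons at equidistant heights with
  radii given by a cosine profile; this works because its step \<open>c\<close> may be chosen with
  \<open>pi / N < c < pi / (N - 1)\<close>. Pulling one vertex of each end polygon triangulates the two flat facets.
  That the visible triangles are all the facets follows since, each edge lying in two of them,
  their cones cover the space.\<close>

section \<open>Polytopes from strictly supported triangulations\<close>

text \<open>Classifying the faces of the hull directly would require every supporting plane. With
  the covering argument only the listed triangles need a functional, and each of their edges a
  second triangle; a generic segment then passes from cone to cone without leaving their union.
  Functionals normalised to 1 turn convexity into a one-variable question. Seen from the midpoint of
  an edge, the rows reach alternately \<open>cos (pi / N)\<close> times their radius and the full
  radius. With a cosine profile, two radii at distance two add up to \<open>2 * cos c\<close> times
  the middle one, so both alternating sequences are concave as soon as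
  \<open>cos c < cos (pi / N)\<close>. The order of the collapses matters: the end simplices can be
  thinned only after the cones over them have lost every face joining the apex to a vertex off the
  base edge. For \<open>N = 2\<close> there are no end triangles and \<open>cos (pi / N)\<close>
  vanishes. The tower is then the boundary of a tetrahedron, and several arguments split off this
  case.\<close>

lemma independent_iff_spanning_card:
  fixes B :: "'a::euclidean_space set"
  assumes "finite B" "card B = DIM('a)"
  shows "independent B \<longleftrightarrow> span B = UNIV"
  using card_eq_dim[of B UNIV] assms by auto

lemma dual_basis:
  fixes t :: "'a::euclidean_space set"
  assumes "independent t" "card t = DIM('a)"
  shows "\<exists>d. (\<forall>v\<in>t. \<forall>w\<in>t. d v \<bullet> w = (if v = w then 1 else 0)) \<and>
             (\<forall>x. (\<Sum>v\<in>t. (d v \<bullet> x) *\<^sub>R v) = x)"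
proof -
  have fin: "finite t" using assms(1) by (rule finiteI_independent)
  then have span: "span t = UNIV"
    using assms independent_iff_spanning_card by blast
  \<comment> \<open>The Riesz vector of the coordinate functional of \<open>v\<close>: the adjoint
    of a real-valued linear map, evaluated at 1.\<close>
  define d where "d v = adjoint (\<lambda>x. representation t x v) 1" for v
  have lin: "linear (\<lambda>x. representation t x v)" for v
    using linear_representation[OF assms(1) span, of v] by (simp add: linear_def real_scaleR_def[abs_def])
  have d: "d v \<bullet> x = representation t x v" for v x
    using adjoint_works[OF lin, of x v 1] by (simp add: d_def inner_commute)
  show ?thesis
  proof (intro exI conjI ballI allI)
    show "d v \<bullet> w = (if v = w then 1 else 0)" if "v \<in> t" "w \<in> t" for v w
      using representation_basis[OF assms(1) that(2)] by (auto simp: d)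
    show "(\<Sum>v\<in>t. (d v \<bullet> x) *\<^sub>R v) = x" for x
      using sum_representation_eq[OF assms(1), of x t] span fin by (simp add: d)
  qed
qed


text \<open>Planes at value 1 allow each \<open>t\<close> to be a linear basis, so it spans a
  simplicial cone at the origin. \<open>ridge\<close> says that the triangulated surface has no
  boundary; that the origin is interior and that \<open>T\<close> lists all facets are
  consequences.\<close>

locale strictly_supported_triangulation =
  fixes V :: "'a::euclidean_space set" and T :: "'a set set" and f :: "'a set \<Rightarrow> 'a"
  assumes fin_V: "finite V" and T_ne: "T \<noteq> {}"
    and T_V: "t \<in> T \<Longrightarrow> t \<subseteq> V"
    and ind: "t \<in> T \<Longrightarrow> independent t"
    and card_t: "t \<in> T \<Longrightarrow> card t = DIM('a)"
    and f_eq: "t \<in> T \<Longrightarrow> v \<in> t \<Longrightarrow> f t \<bullet> v = 1"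
    and f_less: "t \<in> T \<Longrightarrow> v \<in> V - t \<Longrightarrow> f t \<bullet> v < 1"
    and ridge: "t \<in> T \<Longrightarrow> a \<in> t \<Longrightarrow> \<exists>t'\<in>T. t' \<noteq> t \<and> t - {a} \<subseteq> t'"
begin

definition dual :: "'a set \<Rightarrow> 'a \<Rightarrow> 'a" where
  "dual t = (SOME d. (\<forall>v\<in>t. \<forall>w\<in>t. d v \<bullet> w = (if v = w then 1 else 0)) \<and>
                     (\<forall>x. (\<Sum>v\<in>t. (d v \<bullet> x) *\<^sub>R v) = x))"

definition simplex_cone :: "'a set \<Rightarrow> 'a set" where
  "simplex_cone t = {x. \<forall>v\<in>t. 0 \<le> dual t v \<bullet> x}"

lemma dual:
  assumes "t \<in> T"
  shows "\<And>v w. v \<in> t \<Longrightarrow> w \<in> t \<Longrightarrow> dual t v \<bullet> w = (if v = w then 1 else 0)"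
    and "\<And>x. (\<Sum>v\<in>t. (dual t v \<bullet> x) *\<^sub>R v) = x"
proof -
  from someI_ex[OF dual_basis[OF ind[OF assms] card_t[OF assms]]]
  show "\<And>v w. v \<in> t \<Longrightarrow> w \<in> t \<Longrightarrow> dual t v \<bullet> w = (if v = w then 1 else 0)"
    and "\<And>x. (\<Sum>v\<in>t. (dual t v \<bullet> x) *\<^sub>R v) = x"
    unfolding dual_def by blast+
qed

lemma fin_T: "finite T"
  using T_V fin_V by (meson Pow_iff finite_Pow_iff finite_subset subsetI)

lemma fin_t: "t \<in> T \<Longrightarrow> finite t"
  using T_V fin_V finite_subset by blast

lemma f_coords:
  assumes "t \<in> T"
  shows "f t \<bullet> x = (\<Sum>v\<in>t. dual t v \<bullet> x)"
proof -
  have "f t \<bullet> x = f t \<bullet> (\<Sum>v\<in>t. (dual t v \<bullet> x) *\<^sub>R v)"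
    by (simp add: dual(2)[OF assms])
  also have "\<dots> = (\<Sum>v\<in>t. dual t v \<bullet> x)"
    using f_eq[OF assms] by (simp add: inner_sum_right)
  finally show ?thesis .
qed

lemma closed_simplex_cone: "closed (simplex_cone t)"
proof -
  have "simplex_cone t = (\<Inter>v\<in>t. {x. dual t v \<bullet> x \<ge> 0})"
    by (auto simp: simplex_cone_def)
  then show ?thesis
    using closed_halfspace_ge[of 0] by (auto intro!: closed_INT)
qed

text \<open>Coordinates that are positive at \<open>p\<close> stay so for a short time, and those
  that vanish do not decrease along \<open>y\<close>.\<close>

lemma eventually_in_cone:
  assumes "t \<in> T" "\<And>v. v \<in> t \<Longrightarrow> 0 \<le> dual t v \<bullet> p"
    and "\<And>v. v \<in> t \<Longrightarrow> dual t v \<bullet> p = 0 \<Longrightarrow> 0 \<le> dual t v \<bullet> y"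
  shows "\<forall>\<^sub>F s in at_right 0. p + s *\<^sub>R y \<in> simplex_cone t"
proof -
  have "\<forall>\<^sub>F s in at_right 0. 0 \<le> dual t v \<bullet> (p + s *\<^sub>R y)" if "v \<in> t" for v
  proof (cases "dual t v \<bullet> p = 0")
    case True
    then show ?thesis
      using assms(3)[OF that] by (auto simp: inner_add_right eventually_at_filter)
  next
    case False
    then have pos: "0 < dual t v \<bullet> p" using assms(2)[OF that] by simp
    have "((\<lambda>s. dual t v \<bullet> (p + s *\<^sub>R y)) \<longlongrightarrow> dual t v \<bullet> (p + 0 *\<^sub>R y)) (at_right 0)"
      by (intro tendsto_intros)
    then have "\<forall>\<^sub>F s in at_right 0. 0 < dual t v \<bullet> (p + s *\<^sub>R y)"
      using pos by (auto dest!: order_tendstoD(1)[of _ _ _ 0])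
    then show ?thesis by (rule eventually_mono) simp
  qed
  then have "\<forall>\<^sub>F s in at_right 0. \<forall>v\<in>t. 0 \<le> dual t v \<bullet> (p + s *\<^sub>R y)"
    using fin_t[OF assms(1)] by (simp add: eventually_ball_finite_distrib)
  then show ?thesis by (simp add: simplex_cone_def)
qed

text \<open>The facets sharing the ridge \<open>t - {a}\<close> lie on opposite sides of its linear span.\<close>

lemma eventually_in_some_cone:
  assumes t: "t \<in> T" and a: "a \<in> t" and p: "p \<in> simplex_cone t"
    and unique: "\<And>v. v \<in> t \<Longrightarrow> dual t v \<bullet> p = 0 \<Longrightarrow> v = a"
  shows "\<exists>t'\<in>T. \<forall>\<^sub>F s in at_right 0. p + s *\<^sub>R y \<in> simplex_cone t'"
proof (cases "dual t a \<bullet> p = 0 \<and> dual t a \<bullet> y < 0")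
  case False
  have "\<forall>\<^sub>F s in at_right 0. p + s *\<^sub>R y \<in> simplex_cone t"
    by (rule eventually_in_cone[OF t]) (use p unique False in \<open>force simp: simplex_cone_def\<close>)+
  then show ?thesis using t by blast
next
  case True
  obtain t' where t': "t' \<in> T" "t' \<noteq> t" "t - {a} \<subseteq> t'"
    using ridge[OF t a] by blast
  have "card t' = card t" using card_t t t'(1) by simp
  then have "a \<notin> t'"
    using t' a fin_t[OF t'(1)] by (metis card_subset_eq insert_Diff insert_subset)
  have "card (t' - (t - {a})) = 1"
    using \<open>card t' = card t\<close> t'(3) a fin_t[OF t] fin_t[OF t'(1)]
    by (metis One_nat_def card_Diff_singleton card_Diff_subset card_gt_0_iff diff_diff_cancel 
        empty_iff finite_Diff Suc_leI)
  then obtain b where b: "t' - (t - {a}) = {b}" by (auto simp: card_1_singleton_iff)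
  then have t'_eq: "t' = insert b (t - {a})" and "b \<in> t'" "b \<notin> t"
    using t'(3) \<open>a \<notin> t'\<close> by blast+
  define k where "k = dual t a \<bullet> b"
  \<comment> \<open>Expanding \<open>b\<close> in the basis \<open>t\<close> and comparing the
    values of \<open>f t\<close> and \<open>f t'\<close> gives
    \<open>k * (1 - f t' \<bullet> a) = f t \<bullet> b - 1\<close>, which is negative.\<close>
  have k_neg: "k < 0"
  proof -
    have "b = k *\<^sub>R a + (\<Sum>v\<in>t-{a}. (dual t v \<bullet> b) *\<^sub>R v)"
      using dual(2)[OF t, of b] fin_t[OF t] a by (simp add: sum.remove k_def)
    then have "f t' \<bullet> b = f t' \<bullet> (k *\<^sub>R a + (\<Sum>v\<in>t-{a}. (dual t v \<bullet> b) *\<^sub>R v))"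
      by simp
    also have "\<dots> = k * (f t' \<bullet> a) + (\<Sum>v\<in>t-{a}. dual t v \<bullet> b)"
      using f_eq[OF t'(1)] t'(3) by (auto simp: inner_add_right inner_sum_right intro!: sum.cong)
    finally have "1 = k * (f t' \<bullet> a) + (\<Sum>v\<in>t-{a}. dual t v \<bullet> b)"
      using f_eq[OF t'(1) \<open>b \<in> t'\<close>] by simp
    moreover have "f t \<bullet> b = k + (\<Sum>v\<in>t-{a}. dual t v \<bullet> b)"
      using f_coords[OF t, of b] fin_t[OF t] a by (simp add: sum.remove k_def)
    moreover have "f t \<bullet> b < 1" "f t' \<bullet> a < 1"
      using f_less[OF t, of b] f_less[OF t'(1), of a] T_V t t'(1) \<open>a \<notin> t'\<close> \<open>b \<in> t'\<close> \<open>b \<notin> t\<close> a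
      by auto
    ultimately have "0 < - k * (1 - f t' \<bullet> a)" "0 < 1 - f t' \<bullet> a"
      by (auto simp: algebra_simps)
    then show ?thesis by (simp add: zero_less_mult_iff mult_less_0_iff)
  qed
  have coords_t': "dual t' v \<bullet> p = dual t v \<bullet> p" if "v \<in> t - {a}" for v
  proof -
    have "p = (\<Sum>w\<in>t-{a}. (dual t w \<bullet> p) *\<^sub>R w)"
      using dual(2)[OF t, of p] fin_t[OF t] a True by (simp add: sum.remove)
    then have "dual t' v \<bullet> p = dual t' v \<bullet> (\<Sum>w\<in>t-{a}. (dual t w \<bullet> p) *\<^sub>R w)"
      by simp
    also have "\<dots> = (\<Sum>w\<in>t-{a}. if v = w then dual t w \<bullet> p else 0)"
      unfolding inner_sum_right using dual(1)[OF t'(1), of v] that t'(3)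
      by (intro sum.cong) (auto simp: subset_iff)
    also have "\<dots> = dual t v \<bullet> p"
      using that fin_t[OF t] by simp
    finally show ?thesis .
  qed
  \<comment> \<open>As \<open>k < 0\<close>, a direction that makes the coordinate at
    \<open>a\<close> negative makes the coordinate at \<open>b\<close> in \<open>t'\<close>
    positive: leaving \<open>t\<close> through the common wall means entering
    \<open>t'\<close>.\<close>
  have coord_b: "dual t a \<bullet> x = k * (dual t' b \<bullet> x)" for x
  proof -
    have "dual t a \<bullet> x = dual t a \<bullet> (\<Sum>w\<in>t'. (dual t' w \<bullet> x) *\<^sub>R w)"
      by (simp add: dual(2)[OF t'(1)])
    also have "\<dots> = (\<Sum>w\<in>t'. (dual t' w \<bullet> x) * (dual t a \<bullet> w))"
      by (simp add: inner_sum_right)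
    also have "\<dots> = (\<Sum>w\<in>t'. if b = w then (dual t' w \<bullet> x) * k else 0)"
      using dual(1)[OF t a] t'_eq by (intro sum.cong) (auto simp: k_def)
    also have "\<dots> = k * (dual t' b \<bullet> x)"
      using \<open>b \<in> t'\<close> fin_t[OF t'(1)] by simp
    finally show ?thesis .
  qed
  have "\<forall>\<^sub>F s in at_right 0. p + s *\<^sub>R y \<in> simplex_cone t'"
  proof (rule eventually_in_cone[OF t'(1)])
    fix v assume v: "v \<in> t'"
    show "0 \<le> dual t' v \<bullet> p"
      using v coords_t'[of v] coord_b[of p] p True k_neg unfolding t'_eq simplex_cone_def by auto
    assume "dual t' v \<bullet> p = 0"
    then have "v = b"
      using v coords_t'[of v] unique[of v] by (auto simp: t'_eq)
    then show "0 \<le> dual t' v \<bullet> y"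
      using coord_b[of y] True k_neg by (metis mult_neg_neg not_le less_asym)
  qed
  then show ?thesis using t'(1) by blast
qed

text \<open>Otherwise follow the segment from a point \<open>z\<close> inside one cone to an
  uncovered point \<open>w\<close> and stop at the last covered point. If at most one coordinate
  vanishes there, \<open>eventually_in_some_cone\<close> continues the segment inside the union, a
  contradiction.\<close>

lemma cones_cover: "(\<Union>t\<in>T. simplex_cone t) = UNIV"
proof (rule ccontr)
  define C where "C = (\<Union>t\<in>T. simplex_cone t)"
  assume "(\<Union>t\<in>T. simplex_cone t) \<noteq> UNIV"
  then have "- C \<noteq> {}" by (auto simp: C_def)
  have "closed C"
    unfolding C_def by (intro closed_UN fin_T ballI closed_simplex_cone)
  obtain t0 where t0: "t0 \<in> T" using T_ne by blast
  define z where "z = \<Sum>t0"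
  \<comment> \<open>Each member is spanned by fewer vectors than the dimension and so is negligible,
    while the nonempty open set of uncovered points is not. Hence \<open>w\<close> can avoid all
    members, which keeps the segment, apart from \<open>z\<close>, off every intersection of two
    walls of a cone.\<close>
  define \<H> where "\<H> = (\<lambda>(t, a, b). span (insert z (t - {a, b}))) ` 
      (SIGMA t:T. {(a, b). a \<in> t \<and> b \<in> t \<and> a \<noteq> b})"
  have "negligible (\<Union>\<H>)"
  proof (rule negligible_Union)
    have "finite (SIGMA t:T. {(a, b). a \<in> t \<and> b \<in> t \<and> a \<noteq> b})"
      by (intro finite_SigmaI fin_T) (auto intro: finite_subset[OF _ finite_cartesian_product[OF fin_t fin_t]])
    then show "finite \<H>" by (simp add: \<H>_def)
    fix H assume "H \<in> \<H>"
    then obtain t a b where H: "H = span (insert z (t - {a, b}))" "t \<in> T" "a \<in> t" "b \<in> t" "a \<noteq> b"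
      by (auto simp: \<H>_def)
    have "card (t - {a, b}) = DIM('a) - 2"
      using H card_t[OF H(2)] fin_t[OF H(2)] by (subst card_Diff_subset) auto
    moreover have "card {a, b} \<le> DIM('a)"
      using H card_t[OF H(2)] fin_t[OF H(2)] card_mono[of t "{a, b}"] by auto
    ultimately have "card (insert z (t - {a, b})) < DIM('a)"
      using H(5) fin_t[OF H(2)] by (auto simp: card_insert_if)
    then have "dim H < DIM('a)"
      using H(1) fin_t[OF H(2)] dim_le_card'[of "insert z (t - {a, b})"] by (simp add: dim_span)
    then show "negligible H" by (rule negligible_lowdim)
  qed
  moreover have "\<not> negligible (- C)"
    using open_not_negligible[of "- C"] \<open>closed C\<close> \<open>- C \<noteq> {}\<close> by (simp add: open_Compl)
  ultimately obtain w where w: "w \<notin> C" "w \<notin> \<Union>\<H>"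
    by (meson ComplD negligible_subset subsetI)
  define S where "S = {s \<in> {0..1}. z + s *\<^sub>R (w - z) \<in> C}"
  have z1: "dual t0 v \<bullet> z = 1" if "v \<in> t0" for v
    using that dual(1)[OF t0] fin_t[OF t0] by (simp add: z_def inner_sum_right)
  have C_event: "\<forall>\<^sub>F s in at_right 0. p + s *\<^sub>R y \<in> C" 
    if "\<forall>\<^sub>F s in at_right 0. p + s *\<^sub>R y \<in> simplex_cone t" "t \<in> T" for p y t
    using that(1) by (rule eventually_mono) (use that(2) in \<open>auto simp: C_def\<close>)
  have ext: "\<exists>s>0. s < e \<and> p + s *\<^sub>R y \<in> C" if "\<forall>\<^sub>F s in at_right 0. p + s *\<^sub>R y \<in> C" "0 < e" for p y and e::real
  proof -
    have "\<forall>\<^sub>F s in at_right 0. s \<in> {0<..<e}"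
      using that(2) by (rule eventually_at_right_real)
    with that(1) have "\<forall>\<^sub>F s in at_right 0. s \<in> {0<..<e} \<and> p + s *\<^sub>R y \<in> C"
      by eventually_elim simp
    then show ?thesis
      using eventually_happens trivial_limit_at_right_real by fastforce
  qed
  have "\<exists>s\<in>S. 0 < s"
  proof -
    have "\<forall>\<^sub>F s in at_right 0. z + s *\<^sub>R (w - z) \<in> simplex_cone t0"
      by (rule eventually_in_cone[OF t0]) (use z1 in auto)
    then obtain s where "0 < s" "s < 1" "z + s *\<^sub>R (w - z) \<in> C"
      using ext[OF C_event[OF _ t0], of z "w - z" 1] by auto
    then show ?thesis by (intro bexI[of _ s]) (auto simp: S_def)
  qed
  moreover have "compact S"
  proof -
    have "closed ({0..1} \<inter> (\<lambda>s. z + s *\<^sub>R (w - z)) -` C)"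
      by (rule continuous_closed_preimage) (auto intro!: continuous_intros \<open>closed C\<close>)
    moreover have "S = {0..1} \<inter> (\<lambda>s. z + s *\<^sub>R (w - z)) -` C" by (auto simp: S_def)
    ultimately show ?thesis
      by (metis Int_lower1 bounded_closed_interval bounded_subset cbox_interval compact_eq_bounded_closed)
  qed
  ultimately obtain s where s: "s \<in> S" "\<And>s'. s' \<in> S \<Longrightarrow> s' \<le> s" "0 < s"
    by (metis compact_attains_sup empty_iff less_le_trans)
  define p where "p = z + s *\<^sub>R (w - z)"
  have "s \<noteq> 1" using s(1) w(1) by (auto simp: S_def)
  then have "s < 1" using s(1) by (auto simp: S_def)
  obtain t where t: "t \<in> T" "p \<in> simplex_cone t"
    using s(1) by (auto simp: S_def C_def p_def)
  have unique: "a = b" if "a \<in> t" "b \<in> t" "dual t a \<bullet> p = 0" "dual t b \<bullet> p = 0" for a b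
  proof (rule ccontr)
    assume "a \<noteq> b"
    have "p = (\<Sum>v\<in>t. (dual t v \<bullet> p) *\<^sub>R v)" by (simp add: dual(2)[OF t(1)])
    also have "\<dots> = (\<Sum>v\<in>t-{a,b}. (dual t v \<bullet> p) *\<^sub>R v)"
      using that fin_t[OF t(1)] by (intro sum.mono_neutral_right) auto
    also have "\<dots> \<in> span (insert z (t - {a, b}))"
      by (intro span_sum span_scale span_base) auto
    finally have "(1/s) *\<^sub>R (p - (1 - s) *\<^sub>R z) \<in> span (insert z (t - {a, b}))"
      by (intro span_scale span_diff span_base[of z]) auto
    moreover have "(1/s) *\<^sub>R (p - (1 - s) *\<^sub>R z) = w"
      using \<open>0 < s\<close> by (simp add: p_def algebra_simps)
    moreover have "span (insert z (t - {a, b})) \<in> \<H>"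
      unfolding \<H>_def using t(1) that \<open>a \<noteq> b\<close> by (intro image_eqI[where x="(t, a, b)"]) auto
    ultimately show False using w(2) by auto
  qed
  have "t \<noteq> {}" using card_t[OF t(1)] DIM_positive[where 'a='a] by auto
  then obtain a where a: "a \<in> t" "\<And>v. v \<in> t \<Longrightarrow> dual t v \<bullet> p = 0 \<Longrightarrow> v = a"
    using unique by (metis all_not_in_conv)
  obtain t' where "t' \<in> T" "\<forall>\<^sub>F s in at_right 0. p + s *\<^sub>R (w - z) \<in> simplex_cone t'"
    using eventually_in_some_cone[OF t(1) a(1) t(2) a(2)] by blast
  then obtain e where "0 < e" "e < 1 - s" "p + e *\<^sub>R (w - z) \<in> C"
    using ext[OF C_event, of p "w - z" t' "1 - s"] \<open>s < 1\<close> by auto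
  then have "s + e \<in> S" using \<open>0 < s\<close> by (auto simp: S_def p_def algebra_simps)
  then show False using s(2) \<open>0 < e\<close> by fastforce
qed


section \<open>Faces of the convex hull\<close>

lemma affine_independent_subset: "t \<in> T \<Longrightarrow> s \<subseteq> t \<Longrightarrow> \<not> affine_dependent s"
  using ind affine_dependent_imp_dependent dependent_mono by blast

lemma mem_convex_hull_t:
  assumes "t \<in> T" "x \<in> simplex_cone t" "f t \<bullet> x = 1"
  shows "x \<in> convex hull t"
proof -
  have "(\<Sum>v\<in>t. (dual t v \<bullet> x) *\<^sub>R v) \<in> convex hull t"
    by (rule convex_sum[OF fin_t[OF assms(1)] convex_convex_hull])
       (use assms f_coords[OF assms(1)] in \<open>auto simp: simplex_cone_def intro: hull_inc\<close>)
  then show ?thesis by (simp add: dual(2)[OF assms(1)])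
qed

text \<open>\<open>f t\<close> is the sum of the coordinates, so it is positive on the nonzero
  points of the cone of \<open>t\<close>, and dividing by it yields convex coefficients. Thus every
  ray from the origin meets a listed facet.\<close>

lemma scaled_mem_convex_hull:
  assumes "x \<noteq> 0"
  obtains t where "t \<in> T" "x \<in> simplex_cone t" "0 < f t \<bullet> x" "(1 / (f t \<bullet> x)) *\<^sub>R x \<in> convex hull t"
proof -
  obtain t where t: "t \<in> T" "x \<in> simplex_cone t"
    using cones_cover by blast
  have nonneg: "\<forall>v\<in>t. 0 \<le> dual t v \<bullet> x" using t(2) by (simp add: simplex_cone_def)
  have "f t \<bullet> x \<noteq> 0"
  proof
    assume "f t \<bullet> x = 0"
    then have "\<forall>v\<in>t. dual t v \<bullet> x = 0"
      using f_coords[OF t(1), of x] fin_t[OF t(1)] nonneg by (simp add: sum_nonneg_eq_0_iff)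
    then show False using dual(2)[OF t(1), of x] assms by simp
  qed
  moreover have "0 \<le> f t \<bullet> x"
    using f_coords[OF t(1), of x] nonneg by (simp add: sum_nonneg)
  ultimately have pos: "0 < f t \<bullet> x" by simp
  moreover have "(1 / (f t \<bullet> x)) *\<^sub>R x \<in> convex hull t"
    by (rule mem_convex_hull_t[OF t(1)]) (use nonneg pos in \<open>auto simp: simplex_cone_def\<close>)
  ultimately show thesis using that t by blast
qed

text \<open>Two opposite rays both meet facets, and the origin lies between the two points.\<close>

lemma zero_mem: "0 \<in> convex hull V"
proof -
  obtain x :: 'a where "x \<in> Basis" using nonempty_Basis by blast
  then have "x \<noteq> 0" "- x \<noteq> 0" by auto
  obtain t where t: "t \<in> T" "0 < f t \<bullet> x" "(1 / (f t \<bullet> x)) *\<^sub>R x \<in> convex hull t"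
    using scaled_mem_convex_hull[OF \<open>x \<noteq> 0\<close>] by blast
  obtain t' where t': "t' \<in> T" "0 < f t' \<bullet> (- x)" "(1 / (f t' \<bullet> (- x))) *\<^sub>R (- x) \<in> convex hull t'"
    using scaled_mem_convex_hull[OF \<open>- x \<noteq> 0\<close>] by blast
  define c where "c = f t \<bullet> x"
  define c' where "c' = f t' \<bullet> (- x)"
  have c: "0 < c" "0 < c'" using t(2) t'(2) by (simp_all only: c_def c'_def)
  have mem: "(1 / c) *\<^sub>R x \<in> convex hull V" "(1 / c') *\<^sub>R (- x) \<in> convex hull V"
    using t t' T_V hull_mono[of _ V convex] unfolding c_def c'_def by blast+
  have "(c / (c + c')) *\<^sub>R (1 / c) *\<^sub>R x + (c' / (c + c')) *\<^sub>R (1 / c') *\<^sub>R (- x) = 0"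
    using c by simp
  moreover have "c / (c + c') + c' / (c + c') = 1"
    using c by (simp flip: add_divide_distrib)
  ultimately show ?thesis
    using convexD[OF convex_convex_hull mem, of "c / (c + c')" "c' / (c + c')"] c by simp
qed

lemma zero_interior: "0 \<in> interior (convex hull V)"
proof -
  \<comment> \<open>\<open>B\<close> exceeds the norm of every \<open>f t\<close>, so in the ball of
    radius \<open>1 / B\<close> all functionals are at most 1 and each nonzero point lies between
    the origin and the facet point on its ray.\<close>
  define B where "B = 1 + (\<Sum>t\<in>T. norm (f t))"
  have "0 < B" unfolding B_def by (simp add: add_pos_nonneg sum_nonneg)
  have "x \<in> convex hull V" if "norm x < 1 / B" for x
  proof (cases "x = 0")
    case False
    from scaled_mem_convex_hull[OF False] obtain t where t: "t \<in> T" "0 < f t \<bullet> x"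
      "(1 / (f t \<bullet> x)) *\<^sub>R x \<in> convex hull t" by blast
    have "norm (f t) \<le> (\<Sum>t\<in>T. norm (f t))"
      using t(1) fin_T by (intro member_le_sum) auto
    then have "f t \<bullet> x \<le> B * (1 / B)"
      using norm_cauchy_schwarz[of "f t" x] that \<open>0 < B\<close>
        mult_mono[of "norm (f t)" B "norm x" "1 / B"] by (simp add: B_def)
    then have "f t \<bullet> x \<le> 1" using \<open>0 < B\<close> by simp
    have "(1 / (f t \<bullet> x)) *\<^sub>R x \<in> convex hull V"
      using t(3) T_V[OF t(1)] hull_mono by blast
    from convexD[OF convex_convex_hull this zero_mem, of "f t \<bullet> x" "1 - f t \<bullet> x"]
    show ?thesis using t(2) \<open>f t \<bullet> x \<le> 1\<close> by simp
  qed (simp add: zero_mem)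
  then have "ball 0 (1 / B) \<subseteq> convex hull V" by (auto simp: mem_ball_0)
  then show ?thesis
    using \<open>0 < B\<close> by (meson centre_in_ball divide_pos_pos interiorI open_ball zero_less_one)
qed

lemma f_le_1:
  assumes "t \<in> T" "x \<in> convex hull V"
  shows "f t \<bullet> x \<le> 1"
proof -
  have "V \<subseteq> {x. f t \<bullet> x \<le> 1}"
    using f_eq[OF assms(1)] f_less[OF assms(1)] by force
  then have "convex hull V \<subseteq> {x. f t \<bullet> x \<le> 1}"
    by (rule hull_minimal) (rule convex_halfspace_le)
  then show ?thesis using assms(2) by blast
qed

lemma facet: 
  assumes t: "t \<in> T"
  shows "convex hull t face_of convex hull V"
proof -
  let ?F = "convex hull V \<inter> {x. f t \<bullet> x = 1}"
  have F: "?F face_of convex hull V"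
    by (rule face_of_Int_supporting_hyperplane_le) (use f_le_1[OF t] in auto)
  obtain S where S: "S \<subseteq> V" "?F = convex hull S"
    by (rule face_of_convex_hull_subset[OF finite_imp_compact[OF fin_V] F])
  have "S \<subseteq> ?F" by (simp add: S(2) hull_subset)
  then have "S \<subseteq> t" using f_less[OF t] S(1) by force
  moreover have "convex hull t \<subseteq> ?F"
    using f_eq[OF t] hull_mono[OF T_V[OF t]]
    by (intro hull_minimal) (auto intro: hull_inc convex_hyperplane convex_Int)
  ultimately have "convex hull t = ?F" using S(2) hull_mono[of S t] by blast
  then show ?thesis using F by simp
qed

text \<open>A relative interior point \<open>z\<close> of a proper face has value
  \<open>c \<le> 1\<close> under the functional of its cone. With \<open>c < 1\<close> it would be a
  shrunk copy of a point of the hull, hence interior. So \<open>z\<close> lies in a facet, which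
  then contains the whole face, and faces of a simplex are spanned by subsets. Conversely, the hull
  of such a subset lies in a plane that misses the origin.\<close>

lemma proper_face_iff:
  "F face_of convex hull V \<and> F \<noteq> convex hull V \<longleftrightarrow> (\<exists>t\<in>T. \<exists>s\<subseteq>t. F = convex hull s)"
proof
  assume F: "F face_of convex hull V \<and> F \<noteq> convex hull V"
  show "\<exists>t\<in>T. \<exists>s\<subseteq>t. F = convex hull s"
  proof (cases "F = {}")
    case True
    then have "F = convex hull {}" by simp
    then show ?thesis using T_ne by blast
  next
    case False
    have "convex F" using F face_of_imp_convex by blast
    with False obtain z where z: "z \<in> rel_interior F"
      using rel_interior_eq_empty[of F] by blast
    then have "z \<in> F" using rel_interior_subset by blast
    have "z \<notin> interior (convex hull V)"
      using F face_of_disjoint_interior[of F "convex hull V"] \<open>z \<in> F\<close> by blast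
    then have "z \<noteq> 0" using zero_interior by blast
    obtain t where t: "t \<in> T" "z \<in> simplex_cone t" "0 < f t \<bullet> z"
      "(1 / (f t \<bullet> z)) *\<^sub>R z \<in> convex hull t"
      using scaled_mem_convex_hull[OF \<open>z \<noteq> 0\<close>] by blast
    define c where "c = f t \<bullet> z"
    have "c \<le> 1"
      using f_le_1[OF t(1)] F \<open>z \<in> F\<close> face_of_imp_subset by (auto simp: c_def)
    have "c = 1"
    proof (rule ccontr)
      assume "c \<noteq> 1"
      have "(1 / c) *\<^sub>R z \<in> convex hull V"
        using t(4) hull_mono[OF T_V[OF t(1)]] by (auto simp: c_def)
      from mem_interior_convex_shrink[OF convex_convex_hull zero_interior this, of "1 - c"]
      have "(1 / c) *\<^sub>R z - (1 - c) *\<^sub>R ((1 / c) *\<^sub>R z) \<in> interior (convex hull V)"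
        using \<open>c \<le> 1\<close> \<open>c \<noteq> 1\<close> t(3) by (simp add: c_def)
      moreover have "(1 / c) *\<^sub>R z - (1 - c) *\<^sub>R ((1 / c) *\<^sub>R z) = (1 / c - (1 - c) * (1 / c)) *\<^sub>R z"
        by (simp only: scaleR_diff_left scaleR_scaleR)
      moreover have "1 / c - (1 - c) * (1 / c) = 1"
        using t(3) by (simp add: c_def field_simps)
      ultimately have "z \<in> interior (convex hull V)"
        by simp
      then show False using \<open>z \<notin> interior (convex hull V)\<close> by blast
    qed
    then have "z \<in> convex hull t" using t(4) by (simp add: c_def)
    then have "F \<subseteq> convex hull t"
      using subset_of_face_of[OF facet[OF t(1)], of F] F z face_of_imp_subset[of F] by blast
    then have "F face_of convex hull t"
      using face_of_subset[of F "convex hull V"] F face_of_imp_subset[OF facet[OF t(1)]] by blast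
    then show ?thesis
      using face_of_convex_hull_affine_independent[OF affine_independent_subset[OF t(1) subset_refl]] t(1)
      by blast
  qed
next
  assume "\<exists>t\<in>T. \<exists>s\<subseteq>t. F = convex hull s"
  then obtain t s where t: "t \<in> T" "s \<subseteq> t" "F = convex hull s" by blast
  then have "F face_of convex hull t"
    using face_of_convex_hull_affine_independent[OF affine_independent_subset[OF t(1) subset_refl]] by blast
  then have "F face_of convex hull V"
    using facet[OF t(1)] by (rule face_of_trans)
  moreover have "F \<subseteq> {x. f t \<bullet> x = 1}"
    unfolding t(3) by (rule hull_minimal) (use f_eq t in \<open>auto intro: convex_hyperplane\<close>)
  then have "0 \<notin> F" by auto
  then have "F \<noteq> convex hull V" using zero_mem by blast
  ultimately show "F face_of convex hull V \<and> F \<noteq> convex hull V" by blast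
qed

theorem simplicial_polytope_hull: "simplicial_polytope (convex hull V)"
  unfolding simplicial_polytope_def
proof (intro conjI allI impI)
  show "polytope (convex hull V)"
    unfolding polytope_def by (intro exI[of _ V] conjI fin_V refl)
  fix F assume "F face_of convex hull V \<and> F \<noteq> convex hull V"
  then obtain t s where t: "t \<in> T" "s \<subseteq> t" "F = convex hull s"
    unfolding proper_face_iff by blast
  have "(int (card s) - 1) simplex F"
    unfolding simplex_def by (intro exI[of _ s] conjI affine_independent_subset[OF t(1,2)] t(3)) simp
  then show "\<exists>d. d simplex F" by (rule exI)
qed

theorem aff_dim_hull: "aff_dim (convex hull V) = DIM('a)"
  using zero_interior by (intro aff_dim_nonempty_interior) blast

theorem boundary_complex_hull: "boundary_complex (convex hull V) = {s. \<exists>t\<in>T. s \<subseteq> t}"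
proof (intro set_eqI iffI)
  have ext: "{v. v extreme_point_of convex hull s} = s" if "t \<in> T" "s \<subseteq> t" for s t
    using extreme_point_of_convex_hull_affine_independent[OF affine_independent_subset[OF that]] by simp
  fix s
  show "s \<in> {s. \<exists>t\<in>T. s \<subseteq> t}" if "s \<in> boundary_complex (convex hull V)"
  proof -
    obtain F where F: "s = {v. v extreme_point_of F}" "F face_of convex hull V \<and> F \<noteq> convex hull V"
      using \<open>s \<in> _\<close> unfolding boundary_complex_def by blast
    obtain t s' where "t \<in> T" "s' \<subseteq> t" "F = convex hull s'"
      using F(2) proper_face_iff[of F] by blast
    then show ?thesis using F(1) ext[of t s'] by auto
  qed
  assume "s \<in> {s. \<exists>t\<in>T. s \<subseteq> t}"
  then obtain t where t: "t \<in> T" "s \<subseteq> t" by blast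
  then have "convex hull s face_of convex hull V \<and> convex hull s \<noteq> convex hull V"
    using proper_face_iff[of "convex hull s"] by blast
  moreover have "s = {v. v extreme_point_of convex hull s}" using ext[OF t] by simp
  ultimately show "s \<in> boundary_complex (convex hull V)"
    unfolding boundary_complex_def by blast
qed

end

lemma independent_image_scale:
  fixes p :: "'i \<Rightarrow> 'a::euclidean_space"
  assumes "finite t" "card t = DIM('a)" "inj_on p t" "independent (p ` t)"
    and "\<And>i. i \<in> t \<Longrightarrow> c i \<noteq> 0"
  shows "independent ((\<lambda>i. c i *\<^sub>R p i) ` t) \<and> inj_on (\<lambda>i. c i *\<^sub>R p i) t"
proof -
  let ?q = "\<lambda>i. c i *\<^sub>R p i"
  have "p i \<in> span (?q ` t)" if "i \<in> t" for i
  proof -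
    have "(1 / c i) *\<^sub>R ?q i \<in> span (?q ` t)"
      using that by (intro span_scale span_base) auto
    then show ?thesis using assms(5)[OF that] by simp
  qed
  then have "span (p ` t) \<subseteq> span (?q ` t)"
    by (intro span_minimal) auto
  moreover have "span (p ` t) = UNIV"
    using independent_iff_spanning_card[of "p ` t"] assms(1-4) by (simp add: card_image)
  ultimately have span: "span (?q ` t) = UNIV" by blast
  then have "DIM('a) \<le> card (?q ` t)"
    using dim_le_card[of UNIV "?q ` t"] assms(1) by simp
  then have card: "card (?q ` t) = card t"
    using assms(1,2) card_image_le[of t ?q] by simp
  then show ?thesis
    using assms(1,2) span independent_iff_spanning_card[of "?q ` t"]
      eq_card_imp_inj_on[OF assms(1) card] by auto
qed

text \<open>Pulling the points in \<open>S\<close> outwards from the origin makes weakly supporting functionals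
  \<open>f\<close> strictly supporting: the corrected functional is \<open>f - s *\<^sub>R g\<close>, for the scaling
  factor \<open>1 / (1 - s)\<close> of the pulled points and small \<open>s\<close>.\<close>

lemma pulled_realization:
  fixes p :: "'i \<Rightarrow> 'a::euclidean_space" and T :: "'i set set"
  assumes "finite (\<Union>T)" "T \<noteq> {}"
    and T: "\<And>t. t \<in> T \<Longrightarrow> card t = DIM('a) \<and> inj_on p t \<and> independent (p ` t)"
    and supp: "\<And>t. t \<in> T \<Longrightarrow> \<exists>f g. (\<forall>i\<in>t. f \<bullet> p i = 1 \<and> g \<bullet> p i = of_bool (i \<in> S)) \<and>
        (\<forall>i\<in>\<Union>T - t. f \<bullet> p i < 1 \<or> f \<bullet> p i = 1 \<and> i \<notin> S \<and> 0 < g \<bullet> p i)"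
    and ridge: "\<And>t a. t \<in> T \<Longrightarrow> a \<in> t \<Longrightarrow> \<exists>t'\<in>T. t' \<noteq> t \<and> t - {a} \<subseteq> t'"
  shows "\<exists>(q :: 'i \<Rightarrow> 'a) P. inj_on q (\<Union>T) \<and> simplicial_polytope P \<and> aff_dim P = DIM('a) \<and>
           boundary_complex P = (\<lambda>s. q ` s) ` {s. \<exists>t\<in>T. s \<subseteq> t}"
proof -
  obtain f g where fg: "\<And>t i. t \<in> T \<Longrightarrow> i \<in> t \<Longrightarrow> f t \<bullet> p i = 1 \<and> g t \<bullet> p i = of_bool (i \<in> S)"
    "\<And>t i. t \<in> T \<Longrightarrow> i \<in> \<Union>T - t \<Longrightarrow> f t \<bullet> p i < 1 \<or> f t \<bullet> p i = 1 \<and> i \<notin> S \<and> 0 < g t \<bullet> p i"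
    using supp by metis
  define c where "c s i = (if i \<in> S then 1 / (1 - s) else 1)" for s :: real and i
  \<comment> \<open>A strict inequality survives small \<open>s\<close> by continuity. An equality
    is broken by the term \<open>- s *\<^sub>R g t\<close>, since \<open>c s i = 1\<close> off
    \<open>S\<close>.\<close>
  have ev: "\<forall>\<^sub>F s in at_right 0. (f t - s *\<^sub>R g t) \<bullet> (c s i *\<^sub>R p i) < 1"
    if "t \<in> T" "i \<in> \<Union>T - t" for t i
    using fg(2)[OF that]
  proof
    assume less: "f t \<bullet> p i < 1"
    have "((\<lambda>s. c s i) \<longlongrightarrow> 1) (at_right 0)"
      unfolding c_def by (cases "i \<in> S") (auto intro!: tendsto_eq_intros)
    then have "((\<lambda>s. (f t - s *\<^sub>R g t) \<bullet> (c s i *\<^sub>R p i)) \<longlongrightarrow> f t \<bullet> p i) (at_right 0)"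
      by (auto intro!: tendsto_eq_intros)
    then show ?thesis using less by (rule order_tendstoD)
  next
    assume "f t \<bullet> p i = 1 \<and> i \<notin> S \<and> 0 < g t \<bullet> p i"
    then show ?thesis
      by (auto simp: c_def inner_diff_left eventually_at_filter)
  qed
  have "finite T" using assms(1) by (rule finite_UnionD)
  then have "\<forall>\<^sub>F s in at_right 0. \<forall>t\<in>T. \<forall>i\<in>\<Union>T - t. (f t - s *\<^sub>R g t) \<bullet> (c s i *\<^sub>R p i) < 1"
    using ev assms(1) by (intro eventually_ball_finite ballI) auto
  moreover have "\<forall>\<^sub>F s in at_right (0::real). s \<in> {0<..<1}"
    by (rule eventually_at_right_real) simp
  ultimately have evs: "\<forall>\<^sub>F s in at_right 0. s \<in> {0<..<1} \<and>
      (\<forall>t\<in>T. \<forall>i\<in>\<Union>T - t. (f t - s *\<^sub>R g t) \<bullet> (c s i *\<^sub>R p i) < 1)"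
    by eventually_elim blast
  then obtain s where s: "0 < s" "s < 1"
    "\<And>t i. t \<in> T \<Longrightarrow> i \<in> \<Union>T - t \<Longrightarrow> (f t - s *\<^sub>R g t) \<bullet> (c s i *\<^sub>R p i) < 1"
    using eventually_happens'[OF trivial_limit_at_right_real evs] by auto
  define q where "q i = c s i *\<^sub>R p i" for i
  define h where "h t = f t - s *\<^sub>R g t" for t
  have h1: "h t \<bullet> q i = 1" if "t \<in> T" "i \<in> t" for t i
    using fg(1)[OF that] s(2) by (simp add: h_def q_def c_def inner_diff_left)
  have h2: "h t \<bullet> q i < 1" if "t \<in> T" "i \<in> \<Union>T - t" for t i
    using s(3)[OF that] by (simp add: h_def q_def)
  have q: "independent (q ` t) \<and> inj_on q t" if "t \<in> T" for t
  proof -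
    have "finite t" using that assms(1) by (meson Union_upper finite_subset)
    then show ?thesis
      unfolding q_def[abs_def] using T[OF that] s(2) by (intro independent_image_scale) (auto simp: c_def)
  qed
  have inj: "inj_on q (\<Union>T)"
  proof (rule inj_onI)
    fix i j assume ij: "i \<in> \<Union>T" "j \<in> \<Union>T" "q i = q j"
    then obtain t where t: "t \<in> T" "i \<in> t" by blast
    then have "j \<in> t" using h1[OF t] h2[OF t(1), of j] ij by fastforce
    then show "i = j" using q[OF t(1)] t(2) ij(3) by (auto dest: inj_onD)
  qed
  then have inj_T: "inj_on ((`) q) T" by (rule inj_on_image)
  define h' where "h' u = h (inv_into T ((`) q) u)" for u
  have h': "h' (q ` t) = h t" if "t \<in> T" for t
    using inv_into_f_f[OF inj_T that] by (simp add: h'_def)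
  interpret strictly_supported_triangulation "q ` \<Union>T" "(`) q ` T" h'
  proof
    show "finite (q ` \<Union>T)" "(`) q ` T \<noteq> {}" using assms(1,2) by auto
    fix u assume "u \<in> (`) q ` T"
    then obtain t where t: "t \<in> T" "u = q ` t" by blast
    show "u \<subseteq> q ` \<Union>T" "independent u" "card u = DIM('a)"
      using t q[OF t(1)] T[OF t(1)] by (auto simp: card_image)
    show "h' u \<bullet> v = 1" if "v \<in> u" for v
      using that t h1 h' by auto
    show "h' u \<bullet> v < 1" if "v \<in> q ` \<Union>T - u" for v
      using that t h2 h' by auto
    fix a assume "a \<in> u"
    then obtain i where i: "i \<in> t" "a = q i" using t by blast
    obtain t' where t': "t' \<in> T" "t' \<noteq> t" "t - {i} \<subseteq> t'" using ridge[OF t(1) i(1)] by blast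
    show "\<exists>u'\<in>(`) q ` T. u' \<noteq> u \<and> u - {a} \<subseteq> u'"
    proof (intro bexI conjI)
      show "q ` t' \<in> (`) q ` T" using t' by blast
      show "q ` t' \<noteq> u" using inj_T t t' by (auto dest: inj_onD)
      show "u - {a} \<subseteq> q ` t'" using t t' i by blast
    qed
  qed
  have "{s. \<exists>t\<in>(`) q ` T. s \<subseteq> t} = (\<lambda>s. q ` s) ` {s. \<exists>t\<in>T. s \<subseteq> t}"
    by (auto simp: subset_image_iff)
  then show ?thesis
    using inj simplicial_polytope_hull aff_dim_hull boundary_complex_hull
    by (intro exI[of _ q] exI[of _ "convex hull (q ` \<Union>T)"] conjI) simp_all
qed

section \<open>Stacked antiprisms\<close>

definition nxt :: "nat \<Rightarrow> nat \<Rightarrow> nat" where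
  "nxt N i = Suc i mod N"

text \<open>The apex has the same angle as the midpoint of the base edge. Since each row is turned
  by half a step, this is index \<open>i\<close> one row up and \<open>nxt N i\<close> one row
  down.\<close>

definition band :: "nat \<Rightarrow> nat \<Rightarrow> nat \<Rightarrow> nat \<Rightarrow> (nat \<times> nat) set" where
  "band N e e' i = {(e, i), (e, nxt N i), (e', if e' = Suc e then i else nxt N i)}"

definition cap :: "nat \<Rightarrow> nat \<Rightarrow> (nat \<times> nat) set" where
  "cap e k = {(e, 0), (e, k), (e, Suc k)}"

definition tower :: "nat \<Rightarrow> (nat \<times> nat) set set" where
  "tower N = {band N e e' i | e e' i. e < N \<and> e' < N \<and> (e' = Suc e \<or> e = Suc e') \<and> i < N} \<union>
     {cap e k | e k. (e = 0 \<or> Suc e = N) \<and> 1 \<le> k \<and> Suc k < N}"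

lemma nxt_less: "0 < N \<Longrightarrow> nxt N i < N"
  by (simp add: nxt_def)

lemma nxt_cases: "i < N \<Longrightarrow> nxt N i = (if Suc i = N then 0 else Suc i)"
  by (auto simp: nxt_def)

lemma nxt_neq: "2 \<le> N \<Longrightarrow> i < N \<Longrightarrow> nxt N i \<noteq> i"
  by (auto simp: nxt_cases)

section \<open>Angles that are integer multiples of \<open>pi / N\<close>\<close>

lemma dvd_iff_eq: 
  assumes "i < N" "i' < N"
  shows "2 * int N dvd 2 * (int i' - int i) \<longleftrightarrow> i' = i"
proof
  assume "2 * int N dvd 2 * (int i' - int i)"
  then have "int N dvd int i' - int i"
    by (subst (asm) dvd_times_left_cancel_iff) auto
  then show "i' = i" using assms zdvd_imp_le[of "int N" "int i' - int i"] zdvd_imp_le[of "int N" "int i - int i'"]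
    by (cases i i' rule: linorder_cases) (auto simp: dvd_diff_commute)
qed simp

lemma dvd_iff_nxt: 
  assumes "i < N" "i' < N"
  shows "2 * int N dvd 2 * (int i' - int i) - 2 \<longleftrightarrow> i' = nxt N i"
proof -
  define x where "x = 2 * (int i' - int (nxt N i))"
  have "2 * (int i' - int i) - 2 = x - (if Suc i = N then 2 * int N else 0)"
    using nxt_cases[OF assms(1)] by (auto simp: x_def algebra_simps)
  then have "2 * int N dvd 2 * (int i' - int i) - 2 \<longleftrightarrow> 2 * int N dvd x"
    by (cases "Suc i = N") (auto simp: dvd_diff_left_iff)
  then show ?thesis
    using dvd_iff_eq[of "nxt N i" N i'] nxt_less[of N i] assms unfolding x_def by simp
qed

lemma cos_sin_cong:
  fixes N :: nat
  assumes "0 < N" "2 * int N dvd k - k'"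
  shows "cos (of_int k * pi / N) = cos (of_int k' * pi / N)"
    and "sin (of_int k * pi / N) = sin (of_int k' * pi / N)"
proof -
  obtain q where "k - k' = 2 * int N * q" using assms(2) by blast
  then have "real_of_int k = k' + 2 * real N * q"
    by (metis add.commute diff_add_cancel of_int_add of_int_mult of_int_numeral of_int_of_nat_eq)
  then have "of_int k * pi / N = of_int k' * pi / N + 2 * pi * of_int q"
    using assms(1) by (simp add: field_simps)
  then show "cos (of_int k * pi / N) = cos (of_int k' * pi / N)"
    "sin (of_int k * pi / N) = sin (of_int k' * pi / N)"
    by (simp_all add: sin_add cos_add)
qed

text \<open>Seen from the midpoint of an edge of a regular polygon, the vertices sit at odd
  multiples of \<open>pi / N\<close>, and only the two ends of that edge are at the least angle
  \<open>pi / N\<close>.\<close>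

lemma cos_odd_less:
  fixes N :: nat
  assumes "2 \<le> N" "odd k" "\<not> 2 * int N dvd k - 1" "\<not> 2 * int N dvd k + 1"
  shows "cos (of_int k * pi / N) < cos (pi / N)"
proof -
  define m where "m = k mod (2 * int N)"
  have m: "0 \<le> m" "m < 2 * int N" using assms(1) by (auto simp: m_def)
  have km: "2 * int N dvd k - m" by (simp add: m_def)
  have "even (k - m)" using km by (rule dvd_trans[rotated]) simp
  then have "odd m" using assms(2) by simp
  have "m \<noteq> 1" using assms(3) km by auto
  have "m \<noteq> 2 * int N - 1"
  proof
    assume "m = 2 * int N - 1"
    then have "k + 1 = (k - m) + 2 * int N" by simp
    then show False using assms(4) km by (metis dvd_add dvd_refl)
  qed
  \<comment> \<open>Reflecting at \<open>pi\<close>, where the cosine is symmetric, moves the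
    residue into the range on which the cosine decreases. Odd residues other than \<open>1\<close>
    and \<open>2 * N - 1\<close> end up beyond 1.\<close>
  define l where "l = (if m \<le> int N then m else 2 * int N - m)"
  have l: "1 < l" "l \<le> int N"
    using m \<open>odd m\<close> \<open>m \<noteq> 1\<close> \<open>m \<noteq> 2 * int N - 1\<close> by (auto simp: l_def elim!: oddE)
  have "cos (of_int k * pi / N) = cos (of_int m * pi / N)"
    using cos_sin_cong(1)[OF _ km] assms(1) by simp
  also have "\<dots> = cos (of_int l * pi / N)"
  proof (cases "m \<le> int N")
    case False
    have "of_int m * pi / N = of_int 2 * pi - of_int (2 * int N - m) * pi / N"
      using assms(1) by (simp add: field_simps)
    then show ?thesis using False by (simp add: l_def cos_diff)
  qed (simp add: l_def)
  also have "\<dots> < cos (pi / N)"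
  proof (rule cos_monotone_0_pi)
    show "pi / N < of_int l * pi / N"
      using l(1) assms(1) by (simp add: divide_strict_right_mono)
    have "real_of_int l \<le> real N" using l(2) by linarith
    then show "of_int l * pi / N \<le> pi"
      using assms(1) by (simp add: field_simps)
  qed simp
  finally show ?thesis .
qed

lemma cos_odd_le:
  fixes N :: nat
  assumes "2 \<le> N" "odd k"
  shows "cos (of_int k * pi / N) \<le> cos (pi / N)"
proof -
  consider "2 * int N dvd k - 1" | "2 * int N dvd k + 1" 
    | "\<not> 2 * int N dvd k - 1" "\<not> 2 * int N dvd k + 1" by blast
  then show ?thesis
  proof cases
    case 1
    then show ?thesis using cos_sin_cong(1)[of N k 1] assms(1) by simp
  next
    case 2
    then show ?thesis using cos_sin_cong(1)[of N k "-1"] assms(1) by simp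
  qed (use cos_odd_less[OF assms] in simp)
qed

lemma cos_even_less:
  fixes N :: nat
  assumes "2 \<le> N" "even k" "\<not> 2 * int N dvd k"
  shows "cos (of_int k * pi / N) < 1"
proof -
  have "cos (of_int k * pi / N) \<noteq> 1"
  proof
    assume "cos (of_int k * pi / N) = 1"
    then obtain x where "of_int k * pi / N = of_int x * 2 * pi"
      by (auto simp: cos_one_2pi_int)
    then have "real_of_int k = real_of_int (2 * int N * x)"
      using assms(1) by (simp add: field_simps)
    then have "k = 2 * int N * x" by (simp only: of_int_eq_iff)
    then show False using assms(3) by simp
  qed
  then show ?thesis using cos_le_one[of "of_int k * pi / N"] by linarith
qed

text \<open>Slopes strictly decrease, so the line through two consecutive values runs strictly above
  all others, on both sides.\<close>

lemma strictly_concave_below_line: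
  fixes a :: "nat \<Rightarrow> real"
  assumes concave: "\<And>j. Suc (Suc j) < N \<Longrightarrow> a j + a (Suc (Suc j)) < 2 * a (Suc j)"
    and "Suc l < N" "j < N" "j \<noteq> l" "j \<noteq> Suc l"
  shows "a j < a l + (real j - real l) * (a (Suc l) - a l)"
proof (cases "l < j")
  case True
  define D where "D = a (Suc l) - a l"
  \<comment> \<open>Slopes and values are carried along together; \<open>k = 0\<close> is the chord
    itself, so strictness starts at \<open>k > 0\<close>.\<close>
  have "Suc (l + k) < N \<Longrightarrow> a (Suc (l + k)) - a (l + k) \<le> D \<and> 
      a (Suc (l + k)) \<le> a l + (k + 1) * D \<and> 
      (0 < k \<longrightarrow> a (Suc (l + k)) - a (l + k) < D \<and> a (Suc (l + k)) < a l + (k + 1) * D)" for k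
  proof (induction k)
    case (Suc k)
    then show ?case using concave[of "l + k"] by (auto simp: algebra_simps)
  qed (simp add: D_def)
  from this[of "j - Suc l"] show ?thesis using True assms by (auto simp: D_def of_nat_diff)
next
  case False
  define D where "D = a (Suc l) - a l"
  have "k \<le> l \<Longrightarrow> a (Suc (l - k)) - a (l - k) \<ge> D \<and> (0 < k \<longrightarrow> a (Suc (l - k)) - a (l - k) > D)
      \<and> a (l - k) \<le> a l - k * D \<and> (0 < k \<longrightarrow> a (l - k) < a l - k * D)" for k
  proof (induction k)
    case (Suc k)
    then have "Suc (l - Suc k) = l - k" "Suc (Suc (l - Suc k)) < N" using assms by auto
    then show ?case using Suc concave[of "l - Suc k"] by (auto simp: algebra_simps)
  qed (simp add: D_def)
  from this[of "l - j"] show ?thesis using False assms by (auto simp: D_def of_nat_diff algebra_simps)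
qed

text \<open>\<open>g\<close> sees only the coefficient of \<open>c\<close>; once that vanishes,
  \<open>f\<close> and \<open>d\<close> give two independent equations for the other two.\<close>

lemma independent_triple:
  fixes a b c :: "'a::real_inner"
  assumes "f \<bullet> a = 1" "f \<bullet> b = 1" "g \<bullet> a = 0" "g \<bullet> b = 0" "g \<bullet> c \<noteq> 0" "d \<bullet> a \<noteq> d \<bullet> b"
  shows "independent {a, b, c}" "a \<noteq> b" "a \<noteq> c" "b \<noteq> c"
proof -
  show ne: "a \<noteq> b" "a \<noteq> c" "b \<noteq> c" using assms by auto
  show "independent {a, b, c}"
  proof (rule independent_if_scalars_zero)
    fix u x assume "(\<Sum>x\<in>{a, b, c}. u x *\<^sub>R x) = 0" and x: "x \<in> {a, b, c}"
    then have *: "u a *\<^sub>R a + u b *\<^sub>R b + u c *\<^sub>R c = 0" using ne by (simp add: add.assoc)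
    have "u c = 0" using arg_cong[OF *, of "\<lambda>x. g \<bullet> x"] assms by (simp add: inner_add_right)
    then have "u a + u b = 0" using arg_cong[OF *, of "\<lambda>x. f \<bullet> x"] assms by (simp add: inner_add_right)
    then have ub: "u b = - u a" by simp
    have "u a * (d \<bullet> a) + u b * (d \<bullet> b) = 0"
      using arg_cong[OF *, of "\<lambda>x. d \<bullet> x"] \<open>u c = 0\<close> by (simp add: inner_add_right)
    then have "u a * (d \<bullet> a - d \<bullet> b) = 0" by (simp add: ub algebra_simps)
    then have "u a = 0" using assms(6) by simp
    then show "u x = 0" using x ub \<open>u c = 0\<close> by auto
  qed simp
qed

lemma exists_functional:
  fixes p :: "'i \<Rightarrow> 'a::euclidean_space"
  assumes "finite t" "card t = DIM('a)" "inj_on p t" "independent (p ` t)"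
  shows "\<exists>g. \<forall>i\<in>t. g \<bullet> p i = y i"
proof -
  have "card (p ` t) = DIM('a)" using assms by (simp add: card_image)
  then obtain d where "\<forall>v\<in>p ` t. \<forall>w\<in>p ` t. d v \<bullet> w = (if v = w then 1 else 0)"
    using dual_basis[OF assms(4)] by blast
  then have d: "d (p j) \<bullet> p i = (if p j = p i then 1 else 0)" if "i \<in> t" "j \<in> t" for i j
    using that by blast
  have "(\<Sum>j\<in>t. y j *\<^sub>R d (p j)) \<bullet> p i = y i" if "i \<in> t" for i
  proof -
    have "(\<Sum>j\<in>t. y j *\<^sub>R d (p j)) \<bullet> p i = (\<Sum>j\<in>t. if j = i then y j else 0)"
      unfolding inner_sum_left using d that inj_onD[OF assms(3)] by (intro sum.cong) auto
    then show ?thesis using that assms(1) by simp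
  qed
  then show ?thesis by blast
qed

text \<open>Row \<open>j\<close> is a regular \<open>N\<close>-gon of radius \<open>radius j\<close> at height \<open>height j\<close>, turned by half a
  step against its neighbouring rows. The profile \<open>cos (c * height)\<close> is positive on all rows because
  \<open>c < pi / (N - 1)\<close>, and curved enough for convexity along the bands because \<open>pi / N < c\<close>.\<close>

locale antiprism_tower =
  fixes N :: nat and c :: real
  assumes N: "2 \<le> N" and c: "pi / N < c" "c < pi / (real N - 1)"
begin

definition height :: "nat \<Rightarrow> real" where
  "height j = real j - (real N - 1) / 2"

definition radius :: "nat \<Rightarrow> real" where
  "radius j = cos (c * height j)"

definition point :: "nat \<times> nat \<Rightarrow> real ^ 3" where
  "point = (\<lambda>(j, i). vector [radius j * cos ((2 * real i + real j) * pi / N),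
     radius j * sin ((2 * real i + real j) * pi / N), height j])"

abbreviation "\<kappa> \<equiv> cos (pi / N)"

lemma c_pos: "0 < c"
  using c(1) by (rule le_less_trans[rotated]) simp

lemma radius_pos:
  assumes "j < N"
  shows "0 < radius j"
proof -
  have "\<bar>height j\<bar> \<le> (real N - 1) / 2"
    using assms by (auto simp: height_def abs_if field_simps)
  then have "c * \<bar>height j\<bar> \<le> c * ((real N - 1) / 2)"
    using c_pos by (intro mult_left_mono) auto
  also have "\<dots> < pi / 2"
    using c(2) N by (simp add: field_simps)
  finally have "\<bar>c * height j\<bar> < pi / 2"
    using c_pos by (simp add: abs_mult)
  then show ?thesis
    unfolding radius_def by (intro cos_gt_zero_pi) auto
qed

lemma kappa: "0 \<le> \<kappa>" "\<kappa> < 1" "cos c < \<kappa>"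
proof -
  have "pi / N \<le> pi / 2" using N by (intro divide_left_mono) auto
  then show "0 \<le> \<kappa>" using N by (intro cos_ge_zero) (auto intro: order_trans[of _ 0])
  have "0 < pi / N" "pi / N \<le> pi" using N by (auto simp: field_simps)
  then show "\<kappa> < 1" using cos_monotone_0_pi[of 0 "pi / N"] by simp
  have "pi / (real N - 1) \<le> pi / 1" using N by (intro divide_left_mono) auto
  then have "c \<le> pi" using c(2) by simp
  then show "cos c < \<kappa>" using c(1) \<open>0 < pi / N\<close> by (intro cos_monotone_0_pi) auto
qed

lemma sin_pos: "0 < sin (pi / N)"
  using N by (intro sin_gt_zero) (auto simp: field_simps)

lemma radius_recurrence: "radius j + radius (Suc (Suc j)) = 2 * cos c * radius (Suc j)"
proof -
  have *: "c * height j = c * height (Suc j) - c" "c * height (Suc (Suc j)) = c * height (Suc j) + c"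
    by (auto simp: height_def algebra_simps)
  show ?thesis unfolding radius_def * by (simp add: cos_add cos_diff)
qed

text \<open>The largest value on row \<open>j\<close> of the horizontal unit functional pointing
  to the midpoint of an edge of row \<open>e\<close>.\<close>

definition reach :: "nat \<Rightarrow> nat \<Rightarrow> real" where
  "reach e j = (if even (j + e) then \<kappa> else 1) * radius j"

text \<open>The factors 1 and \<open>\<kappa>\<close> alternate with the rows. The recurrence for
  the radii leaves \<open>\<kappa> * cos c < 1\<close> for one parity of the middle row and
  \<open>cos c < \<kappa>\<close> for the other; the latter is where \<open>pi / N < c\<close>
  enters.\<close>

lemma reach_concave:
  assumes "Suc (Suc j) < N"
  shows "reach e j + reach e (Suc (Suc j)) < 2 * reach e (Suc j)"
proof -
  have pos: "0 < radius (Suc j)" using radius_pos assms by simp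
  show ?thesis
  proof (cases "even (j + e)")
    case True
    have "\<kappa> * cos c \<le> \<kappa>"
      using mult_left_mono[OF cos_le_one[of c] kappa(1)] by simp
    then have "\<kappa> * cos c < 1" using kappa(2) by linarith
    have "reach e j + reach e (Suc (Suc j)) = \<kappa> * (radius j + radius (Suc (Suc j)))"
      using True by (simp add: reach_def algebra_simps)
    also have "\<dots> = 2 * ((\<kappa> * cos c) * radius (Suc j))"
      by (simp add: radius_recurrence)
    also have "\<dots> < 2 * (1 * radius (Suc j))"
      using pos \<open>\<kappa> * cos c < 1\<close> by (simp only: mult_less_cancel_left_pos mult_less_cancel_right_pos zero_less_numeral)
    finally show ?thesis using True by (simp add: reach_def)
  next
    case False
    then have "reach e j + reach e (Suc (Suc j)) = 2 * (cos c * radius (Suc j))"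
      using radius_recurrence[of j] by (simp add: reach_def)
    also have "\<dots> < 2 * (\<kappa> * radius (Suc j))"
      using pos kappa(3) by simp
    finally show ?thesis using False by (simp add: reach_def)
  qed
qed

lemma reach_nonneg: "j < N \<Longrightarrow> 0 \<le> reach e j"
  using radius_pos[of j] kappa(1) by (simp add: reach_def)

text \<open>By concavity, the line through two consecutive points of \<open>reach\<close> over
  \<open>height\<close> lies above all the others. Dividing by its value \<open>L\<close> at height
  0 gives the normal form, which needs \<open>L > 0\<close>.\<close>

lemma reach_line:
  assumes "Suc l < N"
  obtains A B where "0 < A" "A * reach e l + B * height l = 1" "A * reach e (Suc l) + B * height (Suc l) = 1"
    "\<And>j. j < N \<Longrightarrow> j \<noteq> l \<Longrightarrow> j \<noteq> Suc l \<Longrightarrow> A * reach e j + B * height j < 1"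
proof -
  define D where "D = reach e (Suc l) - reach e l"
  define L where "L = reach e l - D * height l"
  have eq: "reach e l - D * height l = L" "reach e (Suc l) - D * height (Suc l) = L"
    by (auto simp: L_def D_def height_def algebra_simps)
  have less: "reach e j - D * height j < L" if "j < N" "j \<noteq> l" "j \<noteq> Suc l" for j
  proof -
    have "reach e j < reach e l + (real j - real l) * D"
      unfolding D_def using strictly_concave_below_line[of N "reach e" l j] reach_concave assms that by blast
    moreover have "real j - real l = height j - height l" by (simp add: height_def)
    ultimately show ?thesis by (simp add: L_def algebra_simps)
  qed
  have le: "reach e j - D * height j \<le> L" if "j < N" for j
    using that eq less[OF that] by (cases "j = l \<or> j = Suc l") (auto intro: less_imp_le)
  have sym: "height (N - Suc 0) = - height 0"
    using N by (simp add: height_def of_nat_diff field_simps)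
  \<comment> \<open>The end rows have opposite heights, so adding their relations cancels the slope
    and bounds the sum of their reaches by \<open>2 * L\<close>. For \<open>N = 2\<close> the factor
    \<open>\<kappa>\<close> is 0 and only one of the two reaches is positive.\<close>
  have "0 < L"
  proof (cases "N = 2")
    case True
    then have "l = 0" using assms by simp
    have "0 < reach e 0 + reach e 1"
    proof (cases "even e")
      case True
      then have "0 < reach e 1" using radius_pos[of 1] N by (simp add: reach_def)
      then show ?thesis using reach_nonneg[of 0 e] N by simp
    next
      case False
      then have "0 < reach e 0" using radius_pos[of 0] N by (simp add: reach_def)
      then show ?thesis using reach_nonneg[of 1 e] N by simp
    qed
    moreover have "height 1 = - height 0"
      unfolding height_def using \<open>N = 2\<close> by simp
    ultimately show ?thesis using eq \<open>l = 0\<close> by simp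
  next
    case False
    then have "pi / N < pi / 2" using N by (intro divide_strict_left_mono) auto
    then have "0 < \<kappa>" using N by (intro cos_gt_zero) auto
    then have "0 < reach e 0" "0 < reach e (N - Suc 0)"
      using radius_pos[of 0] radius_pos[of "N - Suc 0"] N by (auto simp: reach_def)
    then show ?thesis using le[of 0] le[of "N - Suc 0"] sym N by simp
  qed
  show thesis
  proof
    have *: "1 / L * reach e j + - D / L * height j = (reach e j - D * height j) / L" for j
      by (simp add: diff_divide_distrib)
    show "0 < 1 / L" using \<open>0 < L\<close> by simp
    show "1 / L * reach e l + - D / L * height l = 1"
      "1 / L * reach e (Suc l) + - D / L * height (Suc l) = 1"
      unfolding * eq using \<open>0 < L\<close> by simp_all
    show "1 / L * reach e j + - D / L * height j < 1" if "j < N" "j \<noteq> l" "j \<noteq> Suc l" for j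
      unfolding * using less[OF that] \<open>0 < L\<close> by simp
  qed
qed

text \<open>Horizontal vectors pointing to, and orthogonal to the direction of, the midpoint of the edge
  from \<open>(e, i)\<close> to \<open>(e, nxt N i)\<close>.\<close>

definition mid :: "nat \<Rightarrow> nat \<Rightarrow> real ^ 3" where
  "mid e i = vector [cos ((2 * real i + real e + 1) * pi / N), sin ((2 * real i + real e + 1) * pi / N), 0]"

definition orth :: "nat \<Rightarrow> nat \<Rightarrow> real ^ 3" where
  "orth e i = vector [- sin ((2 * real i + real e + 1) * pi / N), cos ((2 * real i + real e + 1) * pi / N), 0]"

definition vert :: "real ^ 3" where
  "vert = vector [0, 0, 1]"

text \<open>The angle from the midpoint direction of edge \<open>i\<close> of row \<open>e\<close>
  to the vertex \<open>(j, i')\<close>, in units of \<open>pi / N\<close>. As an integer it is odd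
  exactly when \<open>j\<close> and \<open>e\<close> have the same parity, and coincidence of
  directions becomes divisibility by \<open>2 * N\<close>.\<close>

definition offset :: "nat \<Rightarrow> nat \<Rightarrow> nat \<Rightarrow> nat \<Rightarrow> int" where
  "offset e i j i' = 2 * (int i' - int i) - 1 + (int j - int e)"

lemma offset_angle: 
  "of_int (offset e i j i') * pi / N = (2 * real i' + real j) * pi / N - (2 * real i + real e + 1) * pi / N"
  by (simp add: offset_def algebra_simps diff_divide_distrib add_divide_distrib)

lemma inner_point:
  "vert \<bullet> point (j, i') = height j"
  "mid e i \<bullet> point (j, i') = radius j * cos (of_int (offset e i j i') * pi / N)"
  "orth e i \<bullet> point (j, i') = radius j * sin (of_int (offset e i j i') * pi / N)"
  unfolding offset_angle
  by (simp_all add: vert_def mid_def orth_def point_def inner_vec_def sum_3 vector_3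
        cos_diff sin_diff algebra_simps)

lemma offset_same_row: "offset e i e i' = 2 * (int i' - int i) - 1"
  by (simp add: offset_def)

lemma same_row:
  assumes "i < N" "i' < N"
  shows "cos (of_int (offset e i e i') * pi / N) = \<kappa> \<longleftrightarrow> i' = i \<or> i' = nxt N i"
    and "cos (of_int (offset e i e i') * pi / N) \<le> \<kappa>"
proof -
  have odd: "odd (offset e i e i')" by (simp add: offset_same_row)
  show "cos (of_int (offset e i e i') * pi / N) \<le> \<kappa>"
    by (rule cos_odd_le[OF N odd])
  have d1: "2 * int N dvd offset e i e i' - 1 \<longleftrightarrow> i' = nxt N i"
    using dvd_iff_nxt[OF assms] by (simp add: offset_same_row)
  have d2: "2 * int N dvd offset e i e i' + 1 \<longleftrightarrow> i' = i"
    using dvd_iff_eq[OF assms] by (simp add: offset_same_row)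
  show "cos (of_int (offset e i e i') * pi / N) = \<kappa> \<longleftrightarrow> i' = i \<or> i' = nxt N i"
  proof
    assume "cos (of_int (offset e i e i') * pi / N) = \<kappa>"
    then show "i' = i \<or> i' = nxt N i"
      using cos_odd_less[OF N odd] d1 d2 by force
  next
    assume "i' = i \<or> i' = nxt N i"
    then show "cos (of_int (offset e i e i') * pi / N) = \<kappa>"
      using cos_sin_cong(1)[of N "offset e i e i'" 1] cos_sin_cong(1)[of N "offset e i e i'" "-1"] d1 d2 N
      by auto
  qed
qed

lemma orth_same_row:
  assumes "i < N" "e < N"
  shows "orth e i \<bullet> point (e, i) < 0" "0 < orth e i \<bullet> point (e, nxt N i)"
proof -
  have "offset e i e i = -1" by (simp add: offset_def)
  then show "orth e i \<bullet> point (e, i) < 0"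
    using radius_pos[OF assms(2)] sin_pos by (simp add: inner_point mult_less_0_iff)
  have "2 * int N dvd offset e i e (nxt N i) - 1"
    using dvd_iff_nxt[OF assms(1), of "nxt N i"] nxt_less[of N i] N by (simp add: offset_same_row)
  then have "sin (of_int (offset e i e (nxt N i)) * pi / N) = sin (pi / N)"
    using cos_sin_cong(2)[of N "offset e i e (nxt N i)" 1] N by simp
  then show "0 < orth e i \<bullet> point (e, nxt N i)"
    using radius_pos[OF assms(2)] sin_pos by (simp add: inner_point)
qed

lemma next_row:
  assumes "i < N" "i' < N" "e' = Suc e \<or> e = Suc e'"
  shows "cos (of_int (offset e i e' i') * pi / N) = 1 \<longleftrightarrow> i' = (if e' = Suc e then i else nxt N i)"
proof -
  have even: "even (offset e i e' i')" using assms(3) by (auto simp: offset_def)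
  have d: "2 * int N dvd offset e i e' i' \<longleftrightarrow> i' = (if e' = Suc e then i else nxt N i)"
    using assms(3) dvd_iff_nxt[OF assms(1,2)] dvd_iff_eq[OF assms(1,2)]
    by (auto simp: offset_def)
  show ?thesis
  proof
    show "cos (of_int (offset e i e' i') * pi / N) = 1 \<Longrightarrow> i' = (if e' = Suc e then i else nxt N i)"
      using cos_even_less[OF N even] d by force
    show "i' = (if e' = Suc e then i else nxt N i) \<Longrightarrow> cos (of_int (offset e i e' i') * pi / N) = 1"
      using cos_sin_cong(1)[of N "offset e i e' i'" 0] d N by simp
  qed
qed

lemma mid_le_reach: "j < N \<Longrightarrow> mid e i \<bullet> point (j, i') \<le> reach e j"
proof -
  assume "j < N"
  have "cos (of_int (offset e i j i') * pi / N) \<le> (if even (j + e) then \<kappa> else 1)"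
    using cos_odd_le[OF N, of "offset e i j i'"] by (auto simp: offset_def)
  then show ?thesis
    using radius_pos[OF \<open>j < N\<close>] by (simp add: inner_point reach_def mult.commute mult_right_mono)
qed

text \<open>The functional combines the direction of the base midpoint with a vertical tilt, so that
  on row \<open>j\<close> it is at most \<open>A * reach e j + B * height j\<close>. This bound is 1
  on the rows \<open>e\<close> and \<open>e'\<close>, less than 1 on all others, and on those two
  rows it is attained only at the vertices of the triangle.\<close>

lemma band_support:
  assumes e: "e < N" "e' < N" "e' = Suc e \<or> e = Suc e'" and i: "i < N"
  shows "\<exists>f. \<forall>x \<in> {..<N} \<times> {..<N}. (x \<in> band N e e' i \<longrightarrow> f \<bullet> point x = 1) \<and>
      (x \<notin> band N e e' i \<longrightarrow> f \<bullet> point x < 1)"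
proof -
  \<comment> \<open>The base may be the upper or the lower row of its strip, so the line is indexed
    by the lower one.\<close>
  have "Suc (min e e') < N" using e by auto
  then obtain A B where AB: "0 < A" "A * reach e (min e e') + B * height (min e e') = 1"
    "A * reach e (Suc (min e e')) + B * height (Suc (min e e')) = 1"
    "\<And>j. j < N \<Longrightarrow> j \<noteq> min e e' \<Longrightarrow> j \<noteq> Suc (min e e') \<Longrightarrow> A * reach e j + B * height j < 1"
    using reach_line[of "min e e'" e] by blast
  have AB1: "A * reach e e + B * height e = 1" "A * reach e e' + B * height e' = 1"
    using AB(2,3) e(3) by (auto simp: min_def split: if_splits)
  have AB2: "A * reach e j + B * height j < 1" if "j < N" "j \<noteq> e" "j \<noteq> e'" for j
    using AB(4)[of j] that e(3) by (auto simp: min_def split: if_splits)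
  define f where "f = A *\<^sub>R mid e i + B *\<^sub>R vert"
  have f: "f \<bullet> point (j, i') = A * (mid e i \<bullet> point (j, i')) + B * height j" for j i'
    by (simp add: f_def inner_add_left inner_point(1))
  have f_le: "f \<bullet> point (j, i') \<le> A * reach e j + B * height j" if "j < N" for j i'
    unfolding f using mid_le_reach[OF that] AB(1) by simp
  have f_eq: "f \<bullet> point (j, i') = A * reach e j + B * height j \<longleftrightarrow>
      cos (of_int (offset e i j i') * pi / N) = (if even (j + e) then \<kappa> else 1)" if "j < N" for j i'
    unfolding f using AB(1) radius_pos[OF that] by (simp add: inner_point reach_def)
  have "(x \<in> band N e e' i \<longrightarrow> f \<bullet> point x = 1) \<and> (x \<notin> band N e e' i \<longrightarrow> f \<bullet> point x < 1)"
    if "x \<in> {..<N} \<times> {..<N}" for x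
  proof -
    obtain j i' where "x = (j, i')" by (cases x)
    with that have x: "x = (j, i')" "j < N" "i' < N" by auto
    have e_ne: "e \<noteq> e'" "odd (e' + e)" using e(3) by auto
    consider "j = e" | "j = e'" | "j \<noteq> e" "j \<noteq> e'" by blast
    then show ?thesis
    proof cases
      case 1
      then show ?thesis
        using f_le[OF x(2), of i'] f_eq[OF x(2), of i'] same_row[OF i x(3), of e] AB1(1) e_ne
        by (auto simp: x band_def)
    next
      case 2
      then show ?thesis
        using f_le[OF x(2), of i'] f_eq[OF x(2), of i'] next_row[OF i x(3) e(3)] AB1(2) e_ne
        by (auto simp: x band_def)
    next
      case 3
      then show ?thesis
        using f_le[OF x(2), of i'] AB2[OF x(2)] by (auto simp: x band_def)
    qed
  qed
  then show ?thesis by blast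
qed

end

section \<open>Adjacency of the triangles in the tower\<close>

lemma tower_cases:
  assumes "t \<in> tower N"
  obtains (band) e e' i where "t = band N e e' i" "e < N" "e' < N" "e' = Suc e \<or> e = Suc e'" "i < N"
  | (cap) e k where "t = cap e k" "e = 0 \<or> Suc e = N" "1 \<le> k" "Suc k < N"
  using assms unfolding tower_def by blast

lemma band_in_tower:
  "e < N \<Longrightarrow> e' < N \<Longrightarrow> e' = Suc e \<or> e = Suc e' \<Longrightarrow> i < N \<Longrightarrow> band N e e' i \<in> tower N"
  unfolding tower_def by blast

lemma cap_in_tower:
  "e = 0 \<or> Suc e = N \<Longrightarrow> 1 \<le> k \<Longrightarrow> Suc k < N \<Longrightarrow> cap e k \<in> tower N"
  unfolding tower_def by blast

lemma tower_subset:
  assumes "t \<in> tower N"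
  shows "t \<subseteq> {..<N} \<times> {..<N}"
  using assms by (cases rule: tower_cases) (auto simp: band_def cap_def nxt_less)

lemma card_tower:
  assumes "2 \<le> N" "t \<in> tower N"
  shows "card t = 3"
  using assms(2)
proof (cases rule: tower_cases)
  case (band e e' i)
  then show ?thesis using nxt_neq[OF assms(1), of i] by (auto simp: band_def card_insert_if)
qed (auto simp: cap_def card_insert_if)

text \<open>Beyond an edge of an end row comes a cap, except for \<open>N = 2\<close>: then the row
  is one edge counted twice, and the band triangle on its other copy is the neighbour. The row
  \<open>e'\<close> is arbitrary, so the given band may be degenerate.\<close>

lemma outer_neighbour:
  assumes "2 \<le> N" "e = 0 \<or> Suc e = N" "i < N"
  shows "\<exists>t'\<in>tower N. {(e, i), (e, nxt N i)} \<subseteq> t' \<and> t' \<noteq> band N e e' i"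
proof (cases "N = 2")
  case True
  define e'' where "e'' = 1 - e"
  have e: "e < N" "e'' < N" "e'' = Suc e \<or> e = Suc e''" 
    using True assms(2) by (auto simp: e''_def)
  have i: "1 - i < N"
    using True by simp
  have "band N e e'' (1 - i) = {(e, 0), (e, 1), (e'', if e'' = Suc e then 1 - i else i)}" 
    using True assms(3) e by (auto simp: band_def less_2_cases_iff nxt_def)
  moreover have "band N e e' i = {(e, 0), (e, 1), (e', if e' = Suc e then i else 1 - i)}" 
    using True assms(3) by (auto simp: band_def less_2_cases_iff nxt_def)
  moreover have "(e'', if e'' = Suc e then 1 - i else i) \<notin> band N e e' i"
    using e assms(3) True unfolding calculation(2) by (auto simp: less_2_cases_iff)
  moreover have "{(e, i), (e, nxt N i)} = {(e, 0), (e, 1)}"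
    using True assms(3) by (auto simp: less_2_cases_iff nxt_def)
  ultimately have "{(e, i), (e, nxt N i)} \<subseteq> band N e e'' (1 - i)" "band N e e'' (1 - i) \<noteq> band N e e' i"
    by blast+
  then show ?thesis
    using band_in_tower[OF e i] by blast
next
  case False
  \<comment> \<open>\<open>cap e k\<close> contains the row edge starting at \<open>k\<close>; the
    two edges at vertex 0 belong to the first and the last cap.\<close>
  define k where "k = (if i = 0 then 1 else if Suc i = N then N - 2 else i)"
  have k: "1 \<le> k" "Suc k < N" using False assms by (auto simp: k_def)
  have sub: "{(e, i), (e, nxt N i)} \<subseteq> cap e k"
    using False assms by (auto simp: cap_def k_def nxt_cases)
  show ?thesis
  proof (cases "e' = e")
    case True
    then have "card (band N e e' i) \<le> 2" by (auto simp: band_def card_insert_if)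
    then show ?thesis
      using sub cap_in_tower[OF assms(2) k] card_tower[OF assms(1) cap_in_tower[OF assms(2) k]]
      by (intro bexI[of _ "cap e k"]) auto
  next
    case False
    then have "band N e e' i \<noteq> cap e k"
      by (auto simp: cap_def band_def)
    then show ?thesis
      using sub cap_in_tower[OF assms(2) k] by (intro bexI[of _ "cap e k"]) auto
  qed
qed

text \<open>In the strip between two rows, triangles standing on one row alternate with triangles
  standing on the other, so dropping a base vertex leads to a triangle with the rows exchanged.
  Dropping the apex leads to the next strip or, on an end row, to \<open>outer_neighbour\<close>.
  Caps adjoin each other along the diagonals from vertex 0.\<close>

lemma tower_ridge:
  assumes N: "2 \<le> N" and t: "t \<in> tower N" and a: "a \<in> t"
  shows "\<exists>t'\<in>tower N. t' \<noteq> t \<and> t - {a} \<subseteq> t'"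
  using t
proof (cases rule: tower_cases)
  case (band e e' i)
  define apex where "apex = (e', if e' = Suc e then i else nxt N i)"
  have flip: "band N e' e j \<noteq> t" if "j < N" for j
  proof
    assume "band N e' e j = t"
    then have "(e', j) \<in> t" "(e', nxt N j) \<in> t" by (auto simp: band_def)
    moreover have "e' \<noteq> e" using band by auto
    ultimately have "nxt N j = j" using band(1) by (simp add: band_def)
    then show False using nxt_neq[OF N that] by simp
  qed
  consider "a = apex" | "a = (e, i)" | "a = (e, nxt N i)"
    using a band by (auto simp: band_def apex_def)
  then show ?thesis
  proof cases
    case 1
    have sub: "t - {a} \<subseteq> {(e, i), (e, nxt N i)}"
      using band 1 by (auto simp: band_def apex_def)
    show ?thesis
    proof (cases "e = 0 \<or> Suc e = N")
      case True
      from outer_neighbour[OF N True band(5), of e']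
      obtain t' where t': "t' \<in> tower N" "{(e, i), (e, nxt N i)} \<subseteq> t'" "t' \<noteq> band N e e' i"
        by (elim bexE conjE)
      show ?thesis
      proof (intro bexI conjI)
        show "t' \<noteq> t" using t'(3) band(1) by simp
        show "t - {a} \<subseteq> t'" using sub t'(2) by (rule subset_trans)
      qed (rule t'(1))
    next
      case False
      define e'' where "e'' = (if e' = Suc e then e - 1 else Suc e)"
      have e'': "e'' < N" "e'' = Suc e \<or> e = Suc e''" "e'' \<noteq> e'" "e \<noteq> e''"
        using False band by (auto simp: e''_def)
      have "(e'', if e'' = Suc e then i else nxt N i) \<in> band N e e'' i"
        by (simp add: band_def)
      moreover have "(e'', if e'' = Suc e then i else nxt N i) \<notin> t"
        using band(1) e''(3,4) by (simp add: band_def)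
      ultimately have "band N e e'' i \<noteq> t" by blast
      moreover have "t - {a} \<subseteq> band N e e'' i" using sub by (auto simp: band_def)
      ultimately show ?thesis
        using band_in_tower[OF band(2) e''(1,2) band(5)] by blast
    qed
  next
    case 2
    define j where "j = (if e' = Suc e then i else nxt N i)"
    have "band N e' e j \<in> tower N"
      using band(2-5) nxt_less[of N i] by (intro band_in_tower) (auto simp: j_def)
    moreover have "j < N" using band(5) nxt_less[of N i] by (simp add: j_def)
    moreover have "t - {a} \<subseteq> band N e' e j"
      using 2 band by (auto simp: band_def j_def)
    ultimately show ?thesis using flip by blast
  next
    case 3
    define pr where "pr = (if i = 0 then N - 1 else i - 1)"
    have pr: "pr < N" "nxt N pr = i" using band(5) by (auto simp: pr_def nxt_def)
    define j where "j = (if e' = Suc e then pr else i)"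
    have "band N e' e j \<in> tower N"
      using band(2-5) pr by (intro band_in_tower) (auto simp: j_def)
    moreover have "j < N" using band(5) pr by (simp add: j_def)
    moreover have "t - {a} \<subseteq> band N e' e j"
      using 3 band pr by (auto simp: band_def j_def)
    ultimately show ?thesis using flip by blast
  qed
next
  case (cap e k)
  define e' where "e' = (if e = 0 then 1 else e - 1)"
  have e': "e < N" "e' < N" "e' = Suc e \<or> e = Suc e'" "e \<noteq> e'" using cap N by (auto simp: e'_def)
  have ne: "band N e e' j \<noteq> t" for j
  proof -
    have "(e', if e' = Suc e then j else nxt N j) \<in> band N e e' j" by (simp add: band_def)
    moreover have "(e', if e' = Suc e then j else nxt N j) \<notin> t"
      using e'(4) cap(1) by (simp add: cap_def)
    ultimately show ?thesis by metis
  qed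
  have outer: ?thesis if "t - {a} \<subseteq> {(e, j), (e, nxt N j)}" "j < N" for j
  proof (intro bexI[of _ "band N e e' j"] conjI ne band_in_tower[OF e'(1-3) that(2)])
    show "t - {a} \<subseteq> band N e e' j" using that(1) by (auto simp: band_def)
  qed
  consider "a = (e, 0)" | "a = (e, k)" | "a = (e, Suc k)"
    using a cap by (auto simp: cap_def)
  then show ?thesis
  proof cases
    case 1
    then show ?thesis using cap by (intro outer[of k]) (auto simp: cap_def nxt_cases)
  next
    case 2
    then have sub: "t - {a} \<subseteq> {(e, 0), (e, Suc k)}" using cap by (auto simp: cap_def)
    show ?thesis
    proof (cases "Suc (Suc k) = N")
      case True
      then show ?thesis using cap sub by (intro outer[of "Suc k"]) (auto simp: nxt_cases)
    next
      case False
      then have "cap e (Suc k) \<in> tower N" using cap by (intro cap_in_tower) auto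
      moreover have "t - {a} \<subseteq> cap e (Suc k)" using sub by (auto simp: cap_def)
      moreover have "(e, k) \<in> t" "(e, k) \<notin> cap e (Suc k)" using cap by (auto simp: cap_def)
      ultimately show ?thesis by blast
    qed
  next
    case 3
    then have sub: "t - {a} \<subseteq> {(e, 0), (e, k)}" using cap by (auto simp: cap_def)
    show ?thesis
    proof (cases "k = 1")
      case True
      then show ?thesis using cap sub by (intro outer[of 0]) (auto simp: nxt_cases)
    next
      case False
      then have "cap e (k - 1) \<in> tower N" using cap by (intro cap_in_tower) auto
      moreover have "t - {a} \<subseteq> cap e (k - 1)" using sub cap False by (auto simp: cap_def)
      moreover have "(e, Suc k) \<in> t" "(e, Suc k) \<notin> cap e (k - 1)" using cap by (auto simp: cap_def)
      ultimately show ?thesis by blast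
    qed
  qed
qed

section \<open>Supporting functionals of the caps and the realization\<close>

context antiprism_tower
begin

lemma band_independent:
  assumes e: "e < N" "e' < N" "e' = Suc e \<or> e = Suc e'" and i: "i < N"
  shows "independent (point ` band N e e' i) \<and> inj_on point (band N e e' i)"
proof -
  define a b w where "a = (e, i)" and "b = (e, nxt N i)" 
    and "w = (e', if e' = Suc e then i else nxt N i)"
  have band: "band N e e' i = {a, b, w}" by (simp add: band_def a_def b_def w_def)
  obtain f where f: "\<And>x. x \<in> {..<N} \<times> {..<N} \<Longrightarrow> x \<in> band N e e' i \<Longrightarrow> f \<bullet> point x = 1"
    using band_support[OF e i] by blast
  have f1: "f \<bullet> point a = 1" "f \<bullet> point b = 1" "f \<bullet> point w = 1"
    using f[of a] f[of b] f[of w] e i nxt_less[of N i] unfolding band by (auto simp: a_def b_def w_def)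
  have "height e' \<noteq> height e" using e(3) by (auto simp: height_def)
  \<comment> \<open>\<open>vert - height e *\<^sub>R f\<close> vanishes on the base edge and equals
    \<open>height e' - height e\<close> at the apex; \<open>orth e i\<close> tells the two ends of
    the base apart.\<close>
  then have "independent {point a, point b, point w} \<and> point a \<noteq> point b \<and> point a \<noteq> point w \<and> point b \<noteq> point w"
    using independent_triple[of f "point a" "point b" "vert - height e *\<^sub>R f" "point w" "orth e i"] f1
      orth_same_row[OF i e(1)]
    by (auto simp: inner_diff_left inner_point(1) a_def b_def w_def)
  then show ?thesis unfolding band by auto
qed

text \<open>The whole end row lies in one horizontal plane, so \<open>f\<close> cannot single out a
  triangle of the fan. Within that plane \<open>g\<close> measures how far a vertex lies behind the
  edge from \<open>k\<close> to \<open>Suc k\<close>, scaled to 1 at the vertex to be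
  pulled.\<close>

lemma cap_support:
  assumes e: "e = 0 \<or> Suc e = N" and k: "1 \<le> k" "Suc k < N"
  shows "\<exists>f g. (\<forall>i. f \<bullet> point (e, i) = 1) \<and> (\<forall>j<N. \<forall>i. j \<noteq> e \<longrightarrow> f \<bullet> point (j, i) < 1) \<and>
    g \<bullet> point (e, 0) = 1 \<and> g \<bullet> point (e, k) = 0 \<and> g \<bullet> point (e, Suc k) = 0 \<and>
    (\<forall>i<N. i \<noteq> k \<and> i \<noteq> Suc k \<longrightarrow> 0 < g \<bullet> point (e, i))"
proof -
  have "e < N" using e N by auto
  have h: "height e = (if e = 0 then - (real N - 1) / 2 else (real N - 1) / 2)"
    using e N by (auto simp: height_def of_nat_diff field_simps)
  define f where "f = (1 / height e) *\<^sub>R vert"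
  have h0: "height e \<noteq> 0" using h N by auto
  have f1: "f \<bullet> point (e, i) = 1" for i
    using h0 by (simp add: f_def inner_point)
  have f2: "f \<bullet> point (j, i) < 1" if "j < N" "j \<noteq> e" for j i
  proof -
    have "height j / height e < 1"
    proof (cases "e = 0")
      case True
      then show ?thesis using that N by (simp add: height_def field_simps)
    next
      case False
      then have "j < e" "0 < height e" using e that h N by auto
      then show ?thesis by (simp add: height_def)
    qed
    then show ?thesis by (simp add: f_def inner_point)
  qed
  \<comment> \<open>Dividing by the radius turns \<open>mid e k\<close> into a cosine on the row,
    whose maximum \<open>\<kappa>\<close> is attained just at the ends of the edge.\<close>
  define g0 where "g0 = \<kappa> *\<^sub>R f - (1 / radius e) *\<^sub>R mid e k"
  have g0: "g0 \<bullet> point (e, i) = \<kappa> - cos (of_int (offset e k e i) * pi / N)" for i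
    using radius_pos[OF \<open>e < N\<close>] by (simp add: g0_def inner_diff_left f1 inner_point)
  have kN: "k < N" "nxt N k = Suc k" using k by (auto simp: nxt_cases)
  have pos: "0 < g0 \<bullet> point (e, i)" if "i < N" "i \<noteq> k" "i \<noteq> Suc k" for i
    using same_row[OF kN(1) that(1), of e] that kN by (auto simp: g0)
  have zero: "g0 \<bullet> point (e, k) = 0" "g0 \<bullet> point (e, Suc k) = 0"
    using same_row(1)[OF kN(1), of k e] same_row(1)[OF kN(1), of "Suc k" e] kN k by (auto simp: g0)
  have pos0: "0 < g0 \<bullet> point (e, 0)" using pos[of 0] k by simp
  show ?thesis
    by (intro exI[of _ f] exI[of _ "(1 / (g0 \<bullet> point (e, 0))) *\<^sub>R g0"])
       (use f1 f2 pos zero pos0 in auto)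
qed

lemma cap_independent:
  assumes e: "e = 0 \<or> Suc e = N" and k: "1 \<le> k" "Suc k < N"
  shows "independent (point ` cap e k) \<and> inj_on point (cap e k)"
proof -
  obtain f g where fg: "\<And>i. f \<bullet> point (e, i) = 1"
    "g \<bullet> point (e, 0) = 1" "g \<bullet> point (e, k) = 0" "g \<bullet> point (e, Suc k) = 0"
    using cap_support[OF assms] by auto
  have kN: "k < N" "nxt N k = Suc k" "e < N" using k e N by (auto simp: nxt_cases)
  have "independent {point (e, k), point (e, Suc k), point (e, 0)} \<and> point (e, k) \<noteq> point (e, Suc k) 
      \<and> point (e, k) \<noteq> point (e, 0) \<and> point (e, Suc k) \<noteq> point (e, 0)"
    using independent_triple[of f "point (e, k)" "point (e, Suc k)" g "point (e, 0)" "orth e k"] fg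
      orth_same_row[OF kN(1,3)] kN(2) by auto
  then show ?thesis unfolding cap_def by (auto simp: insert_commute)
qed

text \<open>Bands are strictly supported already, so any \<open>g\<close> with the prescribed values
  on the triangle serves. Caps need the tie-breaking \<open>g\<close> of \<open>cap_support\<close>;
  the two pulled vertices are the centres of the fans.\<close>

lemma tower_support:
  assumes "t \<in> tower N"
  shows "\<exists>f g. (\<forall>i\<in>t. f \<bullet> point i = 1 \<and> g \<bullet> point i = of_bool (i \<in> {(0, 0), (N - 1, 0)})) \<and>
     (\<forall>i\<in>\<Union>(tower N) - t. f \<bullet> point i < 1 \<or> f \<bullet> point i = 1 \<and> i \<notin> {(0, 0), (N - 1, 0)} \<and> 0 < g \<bullet> point i)"
    (is "\<exists>f g. ?P f g")
proof -
  have grid: "\<Union>(tower N) \<subseteq> {..<N} \<times> {..<N}" using tower_subset by blast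
  show ?thesis using assms
  proof (cases rule: tower_cases)
    case (band e e' i)
    have "finite t" using finite_subset[OF tower_subset[OF assms]] by simp
    then have "\<exists>g. \<forall>x\<in>t. g \<bullet> point x = of_bool (x \<in> {(0, 0), (N - 1, 0)})"
      using exists_functional[of t point] card_tower[OF N assms] band_independent[OF band(2-5)] band(1) by simp
    then obtain g where g: "\<forall>x\<in>t. g \<bullet> point x = of_bool (x \<in> {(0, 0), (N - 1, 0)})" by blast
    obtain f where f: "\<forall>x \<in> {..<N} \<times> {..<N}. (x \<in> t \<longrightarrow> f \<bullet> point x = 1) \<and> (x \<notin> t \<longrightarrow> f \<bullet> point x < 1)"
      using band_support[OF band(2-5)] band(1) by blast
    have "?P f g"
    proof (intro conjI ballI)
      show "f \<bullet> point x = 1" "g \<bullet> point x = of_bool (x \<in> {(0, 0), (N - 1, 0)})" if "x \<in> t" for x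
        using that f g tower_subset[OF assms] by auto
      fix x assume "x \<in> \<Union>(tower N) - t"
      then have "x \<in> {..<N} \<times> {..<N}" "x \<notin> t" using grid by (blast dest: subsetD)+
      then have "f \<bullet> point x < 1" using bspec[OF f, of x] by simp
      then show "f \<bullet> point x < 1 \<or> f \<bullet> point x = 1 \<and> x \<notin> {(0, 0), (N - 1, 0)} \<and> 0 < g \<bullet> point x"
        by (rule disjI1)
    qed
    then show ?thesis by (intro exI)
  next
    case (cap e k)
    obtain f g where fg: "\<forall>i. f \<bullet> point (e, i) = 1"
      "\<forall>j<N. \<forall>i. j \<noteq> e \<longrightarrow> f \<bullet> point (j, i) < 1"
      "g \<bullet> point (e, 0) = 1" "g \<bullet> point (e, k) = 0" "g \<bullet> point (e, Suc k) = 0"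
      "\<forall>i<N. i \<noteq> k \<and> i \<noteq> Suc k \<longrightarrow> 0 < g \<bullet> point (e, i)"
      using cap_support[OF cap(2-4)] by (elim exE conjE)
    have "?P f g"
    proof (intro conjI ballI)
      fix x assume "x \<in> t"
      then have x: "x = (e, 0) \<or> x = (e, k) \<or> x = (e, Suc k)" using cap by (auto simp: cap_def)
      then show "f \<bullet> point x = 1" using fg(1) by auto
      show "g \<bullet> point x = of_bool (x \<in> {(0, 0), (N - 1, 0)})"
        using x fg(3-5) cap by auto
    next
      fix x assume x: "x \<in> \<Union>(tower N) - t"
      obtain j i where ji: "x = (j, i)" by (cases x)
      with x grid have "j < N" "i < N" by auto
      show "f \<bullet> point x < 1 \<or> f \<bullet> point x = 1 \<and> x \<notin> {(0, 0), (N - 1, 0)} \<and> 0 < g \<bullet> point x"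
      proof (cases "j = e")
        case True
        then have "i \<noteq> 0" "i \<noteq> k" "i \<noteq> Suc k" using x ji cap by (auto simp: cap_def)
        then show ?thesis using fg(1,6) \<open>i < N\<close> True ji by auto
      next
        case False
        then show ?thesis using fg(2) \<open>j < N\<close> ji by auto
      qed
    qed
    then show ?thesis by (intro exI)
  qed
qed

lemma tower_independent:
  assumes "t \<in> tower N"
  shows "independent (point ` t) \<and> inj_on point t"
  using assms by (cases rule: tower_cases) (auto simp: band_independent cap_independent)

end

theorem tower_realizable:
  assumes N: "2 \<le> N"
  shows "\<exists>(q :: nat \<times> nat \<Rightarrow> real ^ 3) P. inj_on q (\<Union>(tower N)) \<and> simplicial_polytope P \<and> aff_dim P = 3 \<and>
           boundary_complex P = (\<lambda>s. q ` s) ` {s. \<exists>t\<in>tower N. s \<subseteq> t}"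
proof -
  have "pi / N < pi / (real N - 1)" using N by (intro divide_strict_left_mono) auto
  then obtain c where "pi / N < c" "c < pi / (real N - 1)" using dense by blast
  then interpret antiprism_tower N c using N by unfold_locales
  have "finite (\<Union>(tower N))"
    by (rule finite_subset[of _ "{..<N} \<times> {..<N}"]) (use tower_subset in blast, simp)
  moreover have "band N 0 1 0 \<in> tower N" using N by (intro band_in_tower) auto
  then have "tower N \<noteq> {}" by blast
  ultimately have "\<exists>(q :: nat \<times> nat \<Rightarrow> real ^ 3) P. inj_on q (\<Union>(tower N)) \<and> simplicial_polytope P \<and> 
      aff_dim P = DIM(real ^ 3) \<and> boundary_complex P = (\<lambda>s. q ` s) ` {s. \<exists>t\<in>tower N. s \<subseteq> t}"
  proof (rule pulled_realization)
    fix t assume t: "t \<in> tower N"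
    show "card t = DIM(real ^ 3) \<and> inj_on point t \<and> independent (point ` t)"
      using card_tower[OF N t] tower_independent[OF t] by simp
  qed (rule tower_support, assumption, rule tower_ridge[OF N])
  then show ?thesis by simp
qed

section \<open>Collapses\<close>

lemma collapses_onto_refl: "collapses_onto K K"
  by (simp add: collapses_onto_def)

lemma collapses_onto_trans: "collapses_onto K L \<Longrightarrow> collapses_onto L M \<Longrightarrow> collapses_onto K M"
  by (simp add: collapses_onto_def)

text \<open>Toggling \<open>v\<close> pairs off the faces in \<open>R\<close>; starting with a face that is maximal among those
  without \<open>v\<close>, each pair is an elementary collapse.\<close>

lemma collapse_by_toggling:
  assumes "finite R" "R \<subseteq> K" "{} \<notin> R"
    and up: "\<And>\<rho> \<rho>'. \<rho> \<in> R \<Longrightarrow> \<rho>' \<in> K \<Longrightarrow> \<rho> \<subseteq> \<rho>' \<Longrightarrow> \<rho>' \<in> R"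
    and toggle: "\<And>\<rho>. \<rho> \<in> R \<Longrightarrow> insert v \<rho> \<in> R \<and> \<rho> - {v} \<in> R"
  shows "collapses_onto K (K - R)"
  using assms
proof (induction "card R" arbitrary: R K rule: less_induct)
  case less
  show ?case
  proof (cases "R = {}")
    case False
    define R0 where "R0 = {\<rho> \<in> R. v \<notin> \<rho>}"
    obtain \<rho> where "\<rho> \<in> R" using False by blast
    then have "\<rho> - {v} \<in> R0" using less.prems(5) by (simp add: R0_def)
    then have "R0 \<noteq> {}" "finite R0" using less.prems(1) by (auto simp: R0_def)
    then obtain \<sigma> where \<sigma>: "\<sigma> \<in> R0" "\<And>\<rho>. \<rho> \<in> R0 \<Longrightarrow> \<sigma> \<subseteq> \<rho> \<Longrightarrow> \<sigma> = \<rho>"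
      using finite_has_maximal[of R0] by blast
    define \<tau> where "\<tau> = insert v \<sigma>"
    have v: "v \<notin> \<sigma>" "\<sigma> \<in> R" "\<tau> \<in> R" using \<sigma>(1) less.prems(5) by (auto simp: R0_def \<tau>_def)
    have free: "\<rho> = \<tau>" if "\<rho> \<in> K" "\<sigma> \<subset> \<rho>" for \<rho>
    proof -
      have "\<rho> \<in> R" using less.prems(4)[OF v(2) that(1)] that(2) by blast
      then have "\<rho> - {v} \<in> R0" using less.prems(5) by (auto simp: R0_def)
      moreover have "\<sigma> \<subseteq> \<rho> - {v}" using that(2) v(1) by blast
      ultimately have "\<sigma> = \<rho> - {v}" by (rule \<sigma>(2))
      then show ?thesis using that(2) by (auto simp: \<tau>_def)
    qed
    have "\<sigma> \<subset> \<tau>" using v(1) by (auto simp: \<tau>_def)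
    moreover have "\<sigma> \<noteq> {}" using v(2) less.prems(3) by blast
    ultimately have "elementary_collapse K (K - {\<sigma>, \<tau>})"
      unfolding elementary_collapse_def using v free less.prems(2) by (intro exI[of _ \<sigma>] exI[of _ \<tau>]) auto
    then have "collapses_onto K (K - {\<sigma>, \<tau>})" by (auto simp: collapses_onto_def)
    moreover have "collapses_onto (K - {\<sigma>, \<tau>}) (K - {\<sigma>, \<tau>} - (R - {\<sigma>, \<tau>}))"
    proof (rule less.hyps)
      show "card (R - {\<sigma>, \<tau>}) < card R"
        using v less.prems(1) by (intro psubset_card_mono) auto
      show "finite (R - {\<sigma>, \<tau>})" "R - {\<sigma>, \<tau>} \<subseteq> K - {\<sigma>, \<tau>}" "{} \<notin> R - {\<sigma>, \<tau>}"
        using less.prems by auto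
      show "\<rho>' \<in> R - {\<sigma>, \<tau>}" if "\<rho> \<in> R - {\<sigma>, \<tau>}" "\<rho>' \<in> K - {\<sigma>, \<tau>}" "\<rho> \<subseteq> \<rho>'" for \<rho> \<rho>'
        using less.prems(4)[of \<rho> \<rho>'] that by blast
      fix \<rho> assume \<rho>: "\<rho> \<in> R - {\<sigma>, \<tau>}"
      have "insert v \<rho> \<noteq> \<tau>" "insert v \<rho> \<noteq> \<sigma>" "\<rho> - {v} \<noteq> \<tau>" "\<rho> - {v} \<noteq> \<sigma>"
        using \<rho> v(1) by (auto simp: \<tau>_def)
      then show "insert v \<rho> \<in> R - {\<sigma>, \<tau>} \<and> \<rho> - {v} \<in> R - {\<sigma>, \<tau>}"
        using less.prems(5)[of \<rho>] \<rho> by blast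
    qed
    moreover have "K - {\<sigma>, \<tau>} - (R - {\<sigma>, \<tau>}) = K - R" using v by blast
    ultimately show ?thesis using collapses_onto_trans by metis
  qed (simp add: collapses_onto_refl)
qed

text \<open>Upward closure survives in a smaller complex, and disjointness keeps the remaining
  families whole, so they can be removed one after the other.\<close>

lemma collapse_by_toggling_family:
  assumes "finite X"
    and "\<And>x. x \<in> X \<Longrightarrow> finite (R x) \<and> R x \<subseteq> K \<and> {} \<notin> R x"
    and "\<And>x \<rho> \<rho>'. x \<in> X \<Longrightarrow> \<rho> \<in> R x \<Longrightarrow> \<rho>' \<in> K \<Longrightarrow> \<rho> \<subseteq> \<rho>' \<Longrightarrow> \<rho>' \<in> R x"
    and "\<And>x \<rho>. x \<in> X \<Longrightarrow> \<rho> \<in> R x \<Longrightarrow> insert (v x) \<rho> \<in> R x \<and> \<rho> - {v x} \<in> R x"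
    and "\<And>x y. x \<in> X \<Longrightarrow> y \<in> X \<Longrightarrow> x \<noteq> y \<Longrightarrow> R x \<inter> R y = {}"
  shows "collapses_onto K (K - (\<Union>x\<in>X. R x))"
  using assms
proof (induction X rule: finite_induct)
  case empty
  then show ?case by (simp add: collapses_onto_refl)
next
  case (insert x X)
  have "collapses_onto K (K - (\<Union>x\<in>X. R x))"
    by (rule insert.IH) (use insert.prems in \<open>(simp; fail) | (metis insertCI)\<close>)+
  moreover have "collapses_onto (K - (\<Union>x\<in>X. R x)) (K - (\<Union>x\<in>X. R x) - R x)"
  proof (rule collapse_by_toggling[where v = "v x"])
    show "finite (R x)" "{} \<notin> R x" using insert.prems(1)[of x] by auto
    show "R x \<subseteq> K - (\<Union>x\<in>X. R x)"
      using insert.prems(1)[of x] insert.prems(4)[of x] insert.hyps(2) by blast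
    show "\<rho>' \<in> R x" if "\<rho> \<in> R x" "\<rho>' \<in> K - (\<Union>x\<in>X. R x)" "\<rho> \<subseteq> \<rho>'" for \<rho> \<rho>'
      using insert.prems(2)[of x \<rho> \<rho>'] that by blast
    show "insert (v x) \<rho> \<in> R x \<and> \<rho> - {v x} \<in> R x" if "\<rho> \<in> R x" for \<rho>
      using insert.prems(3)[of x \<rho>] that by blast
  qed
  moreover have "K - (\<Union>x\<in>X. R x) - R x = K - (\<Union>x\<in>insert x X. R x)" by blast
  ultimately show ?case using collapses_onto_trans by metis
qed

lemma elementary_collapse_image:
  assumes "elementary_collapse K L" "inj_on f (\<Union>K)"
  shows "elementary_collapse ((`) f ` K) ((`) f ` L)"
proof -
  obtain \<sigma> \<tau> where *: "\<sigma> \<in> K" "\<tau> \<in> K" "\<sigma> \<noteq> {}" "\<sigma> \<subset> \<tau>" "\<forall>\<rho>\<in>K. \<sigma> \<subset> \<rho> \<longrightarrow> \<rho> = \<tau>" "L = K - {\<sigma>, \<tau>}"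
    using assms(1) unfolding elementary_collapse_def by (elim exE conjE)
  have inj: "inj_on ((`) f) K" using assms(2) by (rule inj_on_image)
  have sub: "f ` \<rho> \<subset> f ` \<rho>' \<longleftrightarrow> \<rho> \<subset> \<rho>'" if "\<rho> \<in> K" "\<rho>' \<in> K" for \<rho> \<rho>'
    using that inj_on_image_subset_iff[OF assms(2), of \<rho> \<rho>'] inj_on_image_subset_iff[OF assms(2), of \<rho>' \<rho>]
    by (auto simp: less_le_not_le)
  have "(`) f ` L = (`) f ` K - {f ` \<sigma>, f ` \<tau>}"
    using inj_on_image_set_diff[OF inj, of K "{\<sigma>, \<tau>}"] *(1,2,6) by simp
  moreover have "\<forall>\<rho>\<in>(`) f ` K. f ` \<sigma> \<subset> \<rho> \<longrightarrow> \<rho> = f ` \<tau>"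
    using *(5) sub[OF *(1)] by auto
  moreover have "f ` \<sigma> \<subset> f ` \<tau>" using sub *(1,2,4) by blast
  moreover have "f ` \<sigma> \<in> (`) f ` K" "f ` \<tau> \<in> (`) f ` K" "f ` \<sigma> \<noteq> {}"
    using *(1-3) by auto
  ultimately have "f ` \<sigma> \<in> (`) f ` K \<and> f ` \<tau> \<in> (`) f ` K \<and> f ` \<sigma> \<noteq> {} \<and> f ` \<sigma> \<subset> f ` \<tau> \<and>
      (\<forall>\<rho>\<in>(`) f ` K. f ` \<sigma> \<subset> \<rho> \<longrightarrow> \<rho> = f ` \<tau>) \<and> (`) f ` L = (`) f ` K - {f ` \<sigma>, f ` \<tau>}"
    by (intro conjI)
  then show ?thesis
    unfolding elementary_collapse_def by (intro exI)
qed

lemma collapses_onto_image: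
  assumes "collapses_onto K L" "inj_on f (\<Union>K)"
  shows "collapses_onto ((`) f ` K) ((`) f ` L)"
proof -
  have "collapses_onto ((`) f ` K) ((`) f ` L) \<and> L \<subseteq> K"
    using assms(1) unfolding collapses_onto_def
  proof (induction rule: rtranclp_induct)
    case (step L M)
    have "inj_on f (\<Union>L)" using step.IH assms(2) by (meson Union_mono inj_on_subset)
    then have "elementary_collapse ((`) f ` L) ((`) f ` M)"
      using elementary_collapse_image step.hyps(2) by blast
    moreover have "M \<subseteq> L" using step.hyps(2) by (auto simp: elementary_collapse_def)
    ultimately show ?case using step.IH by (meson order_trans rtranclp.rtrancl_into_rtrancl)
  qed simp
  then show ?thesis by blast
qed

lemma complex_iso_images:
  assumes "inj_on f (\<Union>K)" "inj_on g (\<Union>K)"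
  shows "complex_iso ((`) f ` K) ((`) g ` K)"
proof -
  define h where "h = g \<circ> inv_into (\<Union>K) f"
  have h: "h (f x) = g x" if "x \<in> \<Union>K" for x
    using that assms(1) by (simp add: h_def)
  have U: "\<Union>((`) f ` K) = f ` \<Union>K" "\<Union>((`) g ` K) = g ` \<Union>K" by auto
  have "bij_betw h (f ` \<Union>K) (g ` \<Union>K)"
    unfolding h_def
    by (rule bij_betw_trans[OF bij_betw_inv_into[OF inj_on_imp_bij_betw[OF assms(1)]] 
          inj_on_imp_bij_betw[OF assms(2)]])
  moreover have "h ` f ` F = g ` F" if "F \<in> K" for F
  proof -
    have "h ` f ` F = (\<lambda>x. h (f x)) ` F" by (simp add: image_image)
    also have "\<dots> = g ` F" using that h by (intro image_cong) auto
    finally show ?thesis .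
  qed
  then have "(\<lambda>F. h ` F) ` (`) f ` K = (`) g ` K"
    by (simp add: image_image)
  ultimately show ?thesis
    unfolding complex_iso_def U by blast
qed

section \<open>Diamonds and cones, and the two rounds of collapses\<close>

definition facet :: "nat \<Rightarrow> nat \<Rightarrow> nat \<Rightarrow> (nat \<times> nat) set" where
  "facet N r i = {(r, i), (r, nxt N i)} \<union> (if Suc r < N then {(Suc r, i)} else {}) \<union>
     (if 0 < r then {(r - 1, nxt N i)} else {}) \<union> (if r = 0 \<or> Suc r = N then {r} \<times> {..<N} else {})"

definition facet_complex :: "nat \<Rightarrow> (nat \<times> nat) set set" where
  "facet_complex N = {F. \<exists>r<N. \<exists>i<N. F \<subseteq> facet N r i}"

lemma mem_facet:
  "(s, k) \<in> facet N r i \<longleftrightarrow> s = r \<and> (k = i \<or> k = nxt N i \<or> (r = 0 \<or> Suc r = N) \<and> k < N) \<or>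
     s = Suc r \<and> Suc r < N \<and> k = i \<or> r = Suc s \<and> k = nxt N i"
  by (auto simp: facet_def)

lemma facet_subset: "r < N \<Longrightarrow> i < N \<Longrightarrow> facet N r i \<subseteq> {..<N} \<times> {..<N}"
  by (auto simp: mem_facet nxt_less)

lemma nxt_inject: "i < N \<Longrightarrow> j < N \<Longrightarrow> nxt N i = nxt N j \<Longrightarrow> i = j"
  by (auto simp: nxt_cases split: if_splits)

lemma mem_band:
  "(s, k) \<in> band N e e' i \<longleftrightarrow> s = e \<and> (k = i \<or> k = nxt N i) \<or> 
     s = e' \<and> (if e' = Suc e then k = i else k = nxt N i)"
  by (auto simp: band_def)

text \<open>The faces of \<open>facet N r i\<close> destroyed in the first round, and those of the flat end rows
  destroyed in the second round.\<close>

definition off_band :: "nat \<Rightarrow> nat \<Rightarrow> nat \<Rightarrow> (nat \<times> nat) set set" where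
  "off_band N r i = {F. F \<subseteq> facet N r i \<and> \<not> F \<subseteq> {r} \<times> {..<N} \<and>
     \<not> F \<subseteq> band N r (Suc r) i \<and> \<not> F \<subseteq> band N r (r - 1) i}"

definition off_fan :: "nat \<Rightarrow> nat \<Rightarrow> (nat \<times> nat) set set" where
  "off_fan N e = {F. F \<subseteq> {e} \<times> {..<N} \<and> (\<forall>k<N. \<not> F \<subseteq> {(e, 0), (e, k), (e, nxt N k)})}"

lemma off_bandE:
  assumes "F \<in> off_band N r i" "i < N" "r < N"
  obtains (mid) "0 < r" "Suc r < N" "(Suc r, i) \<in> F" "(r - 1, nxt N i) \<in> F"
  | (bottom) k where "r = 0" "k < N" "k \<noteq> i" "k \<noteq> nxt N i" "(1, i) \<in> F" "(0, k) \<in> F"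
  | (top) k where "Suc r = N" "0 < r" "k < N" "k \<noteq> i" "k \<noteq> nxt N i" "(r - 1, nxt N i) \<in> F" "(r, k) \<in> F"
proof -
  have F: "F \<subseteq> facet N r i" "\<not> F \<subseteq> {r} \<times> {..<N}"
     "\<not> F \<subseteq> band N r (Suc r) i" "\<not> F \<subseteq> band N r (r - 1) i"
    using assms(1) by (auto simp: off_band_def)
  have nl: "nxt N i < N" using assms(2) nxt_less[of N i] by simp
  obtain s k where sk: "(s, k) \<in> F" "(s, k) \<notin> {r} \<times> {..<N}" using F(2) by auto
  obtain s' k' where sk': "(s', k') \<in> F" "(s', k') \<notin> band N r (Suc r) i" using F(3) by auto
  obtain s'' k'' where sk'': "(s'', k'') \<in> F" "(s'', k'') \<notin> band N r (r - 1) i" using F(4) by auto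
  have mem: "(s, k) \<in> facet N r i" "(s', k') \<in> facet N r i" "(s'', k'') \<in> facet N r i"
    using F(1) sk(1) sk'(1) sk''(1) by auto
  consider "r = 0" | "0 < r" "Suc r = N" | "0 < r" "Suc r < N" using assms(3) by linarith
  then show thesis
  proof cases
    case 1
    then have "s = 1 \<and> k = i" using mem(1) sk(2) assms nl by (auto simp: mem_facet)
    moreover have "s' = 0 \<and> k' < N \<and> k' \<noteq> i \<and> k' \<noteq> nxt N i"
      using mem(2) sk'(2) 1 assms nl by (auto simp: mem_facet mem_band)
    ultimately show ?thesis using bottom[of k'] sk(1) sk'(1) 1 by simp
  next
    case 2
    then have "s = r - 1 \<and> k = nxt N i" using mem(1) sk(2) assms nl by (auto simp: mem_facet)
    moreover have "s'' = r \<and> k'' < N \<and> k'' \<noteq> i \<and> k'' \<noteq> nxt N i"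
      using mem(3) sk''(2) 2 assms nl by (auto simp: mem_facet mem_band)
    ultimately show ?thesis using top[of k''] sk(1) sk''(1) 2 by simp
  next
    case 3
    have "s' = r - 1 \<and> k' = nxt N i"
      using mem(2) sk'(2) 3 by (auto simp: mem_facet mem_band)
    moreover have "s'' = Suc r \<and> k'' = i"
      using mem(3) sk''(2) 3 by (auto simp: mem_facet mem_band)
    ultimately show ?thesis using mid sk'(1) sk''(1) 3 by simp
  qed
qed

text \<open>The pair supplied by \<open>off_bandE\<close> occurs in a single facet. In the two cone
  cases some vertex of the row lies off an edge, so \<open>N \<noteq> 2\<close> and the neighbouring
  row is not an end row as well.\<close>

lemma off_band_unique:
  assumes N: "2 \<le> N" and F: "F \<in> off_band N r i" "F \<subseteq> facet N r' i'"
    and bounds: "r < N" "i < N" "r' < N" "i' < N"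
  shows "r' = r \<and> i' = i"
  using F(1) bounds(2,1)
proof (cases rule: off_bandE)
  case mid
  then have "(Suc r, i) \<in> facet N r' i'" "(r - 1, nxt N i) \<in> facet N r' i'" using F(2) by auto
  then show ?thesis using mid by (auto simp: mem_facet)
next
  case (bottom k)
  then have mem: "(1, i) \<in> facet N r' i'" "(0, k) \<in> facet N r' i'" using F(2) by auto
  have "N \<noteq> 2" using bottom bounds by (auto simp: less_2_cases_iff nxt_def)
  then show ?thesis
    using mem bottom N by (auto simp: mem_facet)
next
  case (top k)
  then have mem: "(r - 1, nxt N i) \<in> facet N r' i'" "(r, k) \<in> facet N r' i'" using F(2) by auto
  have "N \<noteq> 2" using top bounds by (auto simp: less_2_cases_iff nxt_def)
  then show ?thesis
    using mem top N nxt_inject[OF bounds(2,4)] by (auto simp: mem_facet)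
qed

text \<open>The vertex \<open>(r, i)\<close> belongs to the facet, to the row and to both triangles,
  so toggling it affects none of the four inclusions.\<close>

lemma off_band_toggle:
  assumes "F \<in> off_band N r i" "i < N"
  shows "insert (r, i) F \<in> off_band N r i \<and> F - {(r, i)} \<in> off_band N r i"
proof -
  have "(r, i) \<in> facet N r i" "(r, i) \<in> {r} \<times> {..<N}" "(r, i) \<in> band N r (Suc r) i" "(r, i) \<in> band N r (r - 1) i"
    using assms(2) by (auto simp: mem_facet mem_band)
  then show ?thesis using assms(1) unfolding off_band_def by blast
qed

lemma off_fan_toggle:
  assumes "F \<in> off_fan N e" "0 < N"
  shows "insert (e, 0) F \<in> off_fan N e \<and> F - {(e, 0)} \<in> off_fan N e"
  using assms unfolding off_fan_def by auto

lemma empty_not_off_fan: "0 < N \<Longrightarrow> {} \<notin> off_fan N e"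
  unfolding off_fan_def by blast

lemma tower_iff:
  assumes N: "2 \<le> N"
  shows "{F. \<exists>t\<in>tower N. F \<subseteq> t} = facet_complex N - 
     (\<Union>(r, i)\<in>{..<N} \<times> {..<N}. off_band N r i) - (\<Union>e\<in>{0, N - 1}. off_fan N e)" (is "?L = ?R")
proof (intro set_eqI iffI)
  fix F assume "F \<in> ?L"
  then obtain t where t: "t \<in> tower N" "F \<subseteq> t" by blast
  show "F \<in> ?R" using t(1)
  proof (cases rule: tower_cases)
    case (band e e' i)
    have sub: "F \<subseteq> facet N e i"
      using t(2) band by (auto simp: facet_def band_def split: if_splits)
    have "F \<notin> off_band N r j" if "r < N" "j < N" for r j
    proof
      assume F: "F \<in> off_band N r j"
      then have "e = r \<and> i = j" using off_band_unique[OF N F sub that band(2,5)] by simp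
      moreover have "e' = Suc e \<or> e' = e - 1" using band(4) by auto
      ultimately show False using F t(2) band(1) by (auto simp: off_band_def)
    qed
    moreover have "F \<notin> off_fan N r" for r
    proof
      assume F: "F \<in> off_fan N r"
      then have row: "F \<subseteq> {r} \<times> {..<N}" and *: "\<And>k. k < N \<Longrightarrow> \<not> F \<subseteq> {(r, 0), (r, k), (r, nxt N k)}"
        by (auto simp: off_fan_def)
      have sub: "F \<subseteq> {(e, i), (e, nxt N i), (e', if e' = Suc e then i else nxt N i)}"
        using t(2) band(1) by (simp add: band_def)
      show False
      proof (cases "r = e")
        case True
        then have "F \<subseteq> {(r, 0), (r, i), (r, nxt N i)}" using sub row band(4) by auto
        then show False using *[OF band(5)] by blast
      next
        case False
        then have "F \<subseteq> {(r, 0), (r, i), (r, nxt N i)}" using sub row by (auto split: if_splits)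
        then show False using *[OF band(5)] by blast
      qed
    qed
    ultimately show ?thesis using sub band by (auto simp: facet_complex_def)
  next
    case (cap e k)
    have Fc: "F \<subseteq> {(e, 0), (e, k), (e, Suc k)}" using t(2) cap(1) by (simp add: cap_def)
    also have "\<dots> \<subseteq> {e} \<times> {..<N}" using cap(3,4) by simp
    finally have row: "F \<subseteq> {e} \<times> {..<N}" .
    have e: "e < N" using cap N by auto
    have sub: "F \<subseteq> facet N e 0"
      using row cap(2) by (auto simp: facet_def)
    have "F \<notin> off_band N r j" if "r < N" "j < N" for r j
    proof
      assume F: "F \<in> off_band N r j"
      then have "e = r" using off_band_unique[OF N F sub that e] N by simp
      then show False using F row by (auto simp: off_band_def)
    qed
    moreover have "F \<notin> off_fan N r" for r
    proof
      assume F: "F \<in> off_fan N r"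
      then have row': "F \<subseteq> {r} \<times> {..<N}" and *: "\<And>k. k < N \<Longrightarrow> \<not> F \<subseteq> {(r, 0), (r, k), (r, nxt N k)}"
        by (auto simp: off_fan_def)
      have "nxt N k = Suc k" "k < N" using cap(4) by (simp_all add: nxt_cases)
      moreover have "F \<subseteq> {(r, 0), (r, k), (r, Suc k)}"
        using Fc row' by (cases "r = e") auto
      ultimately show False using *[of k] by simp
    qed
    moreover have "F \<in> facet_complex N"
      unfolding facet_complex_def using sub e N by (intro CollectI exI[of _ e] conjI exI[of _ 0]) simp_all
    ultimately show ?thesis by auto
  qed
next
  fix F assume F: "F \<in> ?R"
  then obtain r i where ri: "r < N" "i < N" "F \<subseteq> facet N r i" by (auto simp: facet_complex_def)
  \<comment> \<open>Any neighbouring row will do: it only serves to place a row edge inside some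
    band.\<close>
  define e' where "e' = (if Suc r < N then Suc r else r - 1)"
  have e': "e' < N" "e' = Suc r \<or> r = Suc e'" using ri N by (auto simp: e'_def)
  have edge: "F \<in> ?L" if "F \<subseteq> {(r, j), (r, nxt N j)}" "j < N" for j
  proof -
    have "F \<subseteq> band N r e' j" using that(1) by (auto simp: band_def)
    then show ?thesis using band_in_tower[OF ri(1) e' that(2)] by blast
  qed
  have "F \<notin> off_band N r i" using F ri by auto
  then consider (row) "F \<subseteq> {r} \<times> {..<N}" | (up) "F \<subseteq> band N r (Suc r) i" | (down) "F \<subseteq> band N r (r - 1) i"
    using ri(3) by (auto simp: off_band_def)
  then show "F \<in> ?L"
  proof cases
    case row
    show ?thesis
    proof (cases "r = 0 \<or> Suc r = N")
      case True
      then have "F \<notin> off_fan N r" using F by auto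
      then obtain k where k: "k < N" "F \<subseteq> {(r, 0), (r, k), (r, nxt N k)}"
        using row by (auto simp: off_fan_def)
      \<comment> \<open>\<open>off_fan\<close> admits all \<open>k < N\<close>, whereas caps stop
        short of both ends. For \<open>k = 0\<close> and \<open>k = N - 1\<close> the fan triangle
        degenerates to a row edge, which lies in a band.\<close>
      consider "k = 0" | "Suc k = N" | "1 \<le> k" "Suc k < N" using k by linarith
      then show ?thesis
      proof cases
        case 1
        then show ?thesis using k edge[of 0] by simp
      next
        case 2
        then have "F \<subseteq> {(r, k), (r, nxt N k)}" using k by (auto simp: nxt_cases)
        then show ?thesis using edge k(1) by blast
      next
        case 3
        then have "F \<subseteq> cap r k" using k by (simp add: cap_def nxt_cases)
        then show ?thesis using cap_in_tower[OF True 3] by blast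
      qed
    next
      case False
      then have "F \<subseteq> {(r, i), (r, nxt N i)}" using row ri by (auto simp: facet_def split: if_splits)
      then show ?thesis using edge ri by blast
    qed
  next
    case up
    show ?thesis
    proof (cases "Suc r < N")
      case True
      then show ?thesis using band_in_tower[OF ri(1) True _ ri(2)] up by blast
    next
      case False
      have "F \<subseteq> {(r, i), (r, nxt N i)}"
      proof
        fix x assume "x \<in> F"
        then have "x \<in> facet N r i" "x \<in> band N r (Suc r) i" using ri(3) up by auto
        then show "x \<in> {(r, i), (r, nxt N i)}" using False by (auto simp: facet_def band_def split: if_splits)
      qed
      then show ?thesis using edge ri by blast
    qed
  next
    case down
    show ?thesis
    proof (cases "r = 0")
      case True
      then show ?thesis using edge[of i] ri down by (auto simp: band_def)
    next
      case False
      then have "r - 1 < N" "r = Suc (r - 1)" using ri by auto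
      then show ?thesis using band_in_tower[OF ri(1), of "r - 1" i] ri(2) down by blast
    qed
  qed
qed

lemma facet_complex_collapses:
  assumes N: "2 \<le> N"
  shows "collapses_onto (facet_complex N) {F. \<exists>t\<in>tower N. F \<subseteq> t}"
proof -
  define G where "G = {..<N} \<times> {..<N}"
  define R where "R = (\<lambda>(r, i). off_band N r i)"
  define K where "K = facet_complex N"
  define K1 where "K1 = K - (\<Union>x\<in>G. R x)"
  have finK: "finite K"
  proof -
    have "K \<subseteq> Pow ({..<N} \<times> {..<N})" unfolding K_def facet_complex_def using facet_subset by blast
    then show ?thesis by (rule finite_subset) simp
  qed
  have RK: "R x \<subseteq> K" if "x \<in> G" for x
    using that by (auto simp: R_def K_def facet_complex_def off_band_def G_def)
  have uniq: "x = y" if "x \<in> G" "y \<in> G" "F \<in> R x" "F \<subseteq> facet N (fst y) (snd y)" for x y F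
    using that off_band_unique[OF N, of F "fst x" "snd x" "fst y" "snd y"] 
    by (auto simp: R_def G_def prod_eq_iff split: prod.splits)
  have "collapses_onto K K1"
    unfolding K1_def
  \<comment> \<open>The index \<open>(r, i)\<close> of a facet is at the same time the vertex that
    is toggled in it.\<close>
  proof (rule collapse_by_toggling_family[where v = id])
    show "finite G" by (simp add: G_def)
    fix x assume x: "x \<in> G"
    show "finite (R x) \<and> R x \<subseteq> K \<and> {} \<notin> R x"
      using RK[OF x] finite_subset[OF RK[OF x] finK] by (auto simp: R_def off_band_def split: prod.splits)
    show "\<rho>' \<in> R x" if \<rho>: "\<rho> \<in> R x" "\<rho>' \<in> K" "\<rho> \<subseteq> \<rho>'" for \<rho> \<rho>'
    proof -
      obtain r i where y: "(r, i) \<in> G" "\<rho>' \<subseteq> facet N r i"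
        using \<rho>(2) by (auto simp: K_def facet_complex_def G_def)
      then have "x = (r, i)" using uniq[OF x y(1) \<rho>(1)] \<rho>(3) by simp
      then show ?thesis using \<rho>(1,3) y(2) unfolding R_def off_band_def by auto
    qed
    show "insert (id x) \<rho> \<in> R x \<and> \<rho> - {id x} \<in> R x" if "\<rho> \<in> R x" for \<rho>
      using that x off_band_toggle by (auto simp: R_def G_def split: prod.splits)
    fix y assume y: "y \<in> G" "x \<noteq> y"
    show "R x \<inter> R y = {}"
    proof (rule ccontr)
      assume "R x \<inter> R y \<noteq> {}"
      then obtain F where F: "F \<in> R x" "F \<in> R y" by blast
      then have "F \<subseteq> facet N (fst y) (snd y)" by (auto simp: R_def off_band_def split: prod.splits)
      then show False using uniq[OF x y(1) F(1)] y(2) by blast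
    qed
  qed
  moreover have "collapses_onto K1 (K1 - (\<Union>e\<in>{0, N - 1}. off_fan N e))"
  proof (rule collapse_by_toggling_family[where v = "\<lambda>e. (e, 0)"])
    fix e assume "e \<in> {0, N - 1}"
    then have e: "e < N" "e = 0 \<or> Suc e = N" using N by auto
    have sub: "F \<subseteq> facet N e 0" if "F \<in> off_fan N e" for F
      using that e(2) by (auto simp: off_fan_def facet_def)
    have "F \<in> K1" if F: "F \<in> off_fan N e" for F
    proof -
      have "F \<in> K"
        unfolding K_def facet_complex_def using sub[OF F] e N
        by (intro CollectI exI[of _ e] conjI exI[of _ 0]) simp_all
      moreover have "F \<notin> R x" if "x \<in> G" for x
      proof
        assume "F \<in> R x"
        then have "x = (e, 0)" using uniq[OF that, of "(e, 0)" F] sub[OF F] e N by (simp add: G_def)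
        then show False using \<open>F \<in> R x\<close> F by (auto simp: R_def off_band_def off_fan_def)
      qed
      ultimately show ?thesis by (auto simp: K1_def)
    qed
    then have "off_fan N e \<subseteq> K1" by blast
    moreover have "K1 \<subseteq> K" by (auto simp: K1_def)
    moreover have "{} \<notin> off_fan N e" by (rule empty_not_off_fan) (use N in simp)
    ultimately show "finite (off_fan N e) \<and> off_fan N e \<subseteq> K1 \<and> {} \<notin> off_fan N e"
      using finite_subset[OF _ finK, of "off_fan N e"] by simp
    show "insert (e, 0) \<rho> \<in> off_fan N e \<and> \<rho> - {(e, 0)} \<in> off_fan N e" if "\<rho> \<in> off_fan N e" for \<rho>
      using off_fan_toggle[OF that] N by simp
    \<comment> \<open>If \<open>\<rho>'\<close> belonged to a facet of another row or to a band,
      \<open>\<rho>\<close> would be contained in a fan triangle. The first round has left the end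
      row itself as the only other possibility.\<close>
    show "\<rho>' \<in> off_fan N e" if \<rho>: "\<rho> \<in> off_fan N e" "\<rho>' \<in> K1" "\<rho> \<subseteq> \<rho>'" for \<rho> \<rho>'
    proof -
      have no: "\<not> \<rho> \<subseteq> {(e, 0), (e, k), (e, nxt N k)}" if "k < N" for k
        using \<rho>(1) that by (simp add: off_fan_def)
      have row: "\<rho> \<subseteq> {e} \<times> {..<N}" using \<rho>(1) by (simp add: off_fan_def)
      obtain r i where ri: "r < N" "i < N" "\<rho>' \<subseteq> facet N r i"
        using \<rho>(2) by (auto simp: K1_def K_def facet_complex_def)
      have "r = e"
      proof (rule ccontr)
        assume "r \<noteq> e"
        then have "\<rho> \<subseteq> {(e, 0), (e, i), (e, nxt N i)}"
          using row \<rho>(3) ri(3) by (force simp: facet_def split: if_splits)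
        then show False using no[OF ri(2)] by blast
      qed
      have "\<rho>' \<notin> off_band N e i" using \<rho>(2) ri \<open>r = e\<close> by (auto simp: K1_def R_def G_def)
      moreover have "\<not> \<rho>' \<subseteq> band N e (Suc e) i" "\<not> \<rho>' \<subseteq> band N e (e - 1) i"
      proof -
        have "\<rho> \<subseteq> {(e, 0), (e, i), (e, nxt N i)}" if "\<rho> \<subseteq> band N e e' i" for e'
          using that row by (auto simp: band_def split: if_splits)
        then show "\<not> \<rho>' \<subseteq> band N e (Suc e) i" "\<not> \<rho>' \<subseteq> band N e (e - 1) i"
          using no[OF ri(2)] \<rho>(3) by (meson order_trans)+
      qed
      ultimately have "\<rho>' \<subseteq> {e} \<times> {..<N}" using ri(3) \<open>r = e\<close> by (auto simp: off_band_def)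
      then show ?thesis using no \<rho>(3) by (auto simp: off_fan_def)
    qed
    fix e2 assume "e2 \<in> {0, N - 1}" "e \<noteq> e2"
    show "off_fan N e \<inter> off_fan N e2 = {}"
    proof (rule ccontr)
      assume "off_fan N e \<inter> off_fan N e2 \<noteq> {}"
      then obtain F where F: "F \<in> off_fan N e" "F \<in> off_fan N e2" by blast
      then have "F \<subseteq> ({e} \<times> {..<N}) \<inter> ({e2} \<times> {..<N})" by (simp add: off_fan_def)
      then have "F = {}" using \<open>e \<noteq> e2\<close> by auto
      then show False using F(1) empty_not_off_fan[of N e] N by simp
    qed
  qed simp
  moreover have "K1 - (\<Union>e\<in>{0, N - 1}. off_fan N e) = {F. \<exists>t\<in>tower N. F \<subseteq> t}"
    unfolding tower_iff[OF N] K1_def K_def R_def G_def by simp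
  ultimately show ?thesis
    unfolding K_def using collapses_onto_trans by metis
qed

section \<open>Stable sets as cyclic words\<close>

text \<open>\<open>offs N x e\<close> is the clockwise distance from \<open>x\<close> to \<open>e\<close> in the cyclic order of \<open>{..<N}\<close>.\<close>

definition offs :: "nat \<Rightarrow> nat \<Rightarrow> nat \<Rightarrow> nat" where
  "offs N x e = (if x \<le> e then e - x else e + N - x)"

text \<open>The positions \<open>1, \<dots>, 2 * N\<close> fall into pairs \<open>{2 * e + 1, 2 * e + 2}\<close>. With \<open>N = n + 1\<close>, a stable
  \<open>n\<close>-set misses exactly one pair \<open>x\<close>, takes the odd element of the next \<open>r\<close> pairs, and the even
  element of the remaining ones.\<close>

definition stable_of :: "nat \<Rightarrow> nat \<times> nat \<Rightarrow> nat set" where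
  "stable_of N = (\<lambda>(r, x). {2 * e + 1 | e. e < N \<and> 1 \<le> offs N x e \<and> offs N x e \<le> r} \<union>
     {2 * e + 2 | e. e < N \<and> r < offs N x e})"

lemma mem_stable_of:
  "2 * e + 1 \<in> stable_of N (r, x) \<longleftrightarrow> e < N \<and> 1 \<le> offs N x e \<and> offs N x e \<le> r"
  "2 * e + 2 \<in> stable_of N (r, x) \<longleftrightarrow> e < N \<and> r < offs N x e"
proof -
  have ne: "2 * e + 1 \<noteq> 2 * e' + 2" "2 * e + 2 \<noteq> 2 * e' + 1" for e' :: nat by presburger+
  show "2 * e + 1 \<in> stable_of N (r, x) \<longleftrightarrow> e < N \<and> 1 \<le> offs N x e \<and> offs N x e \<le> r"
    "2 * e + 2 \<in> stable_of N (r, x) \<longleftrightarrow> e < N \<and> r < offs N x e"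
    using ne by (auto simp: stable_of_def)
qed

lemma pair_cases:
  fixes p :: nat
  assumes "p \<in> {1..2 * N}"
  obtains e where "e < N" "p = 2 * e + 1 \<or> p = 2 * e + 2"
proof
  show "(p - 1) div 2 < N" "p = 2 * ((p - 1) div 2) + 1 \<or> p = 2 * ((p - 1) div 2) + 2"
    using assms by auto
qed

lemma stable_of_subset: "stable_of N x \<subseteq> {1..2 * N}"
  by (auto simp: stable_of_def split: prod.splits)

lemma offs_less: "x < N \<Longrightarrow> e < N \<Longrightarrow> offs N x e < N"
  by (auto simp: offs_def)

lemma offs_self [simp]: "offs N x x = 0"
  by (simp add: offs_def)

lemma offs_eq_0: "x < N \<Longrightarrow> e < N \<Longrightarrow> offs N x e = 0 \<longleftrightarrow> e = x"
  by (auto simp: offs_def)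

lemma offs_add: "x < N \<Longrightarrow> j < N \<Longrightarrow> offs N x ((x + j) mod N) = j"
  by (cases "x + j < N") (auto simp: offs_def mod_if)

lemma add_offs: "x < N \<Longrightarrow> e < N \<Longrightarrow> (x + offs N x e) mod N = e"
  by (auto simp: offs_def)

lemma offs_nxt: "x < N \<Longrightarrow> e < N \<Longrightarrow> offs N x (nxt N e) = (if Suc (offs N x e) = N then 0 else Suc (offs N x e))"
  by (auto simp: offs_def nxt_cases)

lemma offs_offs: 
  assumes "i < N" "k < N" "e < N"
  shows "offs N k e = offs N (offs N i k) (offs N i e)"
  using assms by (auto simp: offs_def)

lemma stable_iff:
  assumes "1 \<le> N"
  shows "stable (2 * N) \<alpha> \<longleftrightarrow> \<alpha> \<subseteq> {1..2 * N} \<and>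
     (\<forall>e<N. \<not> (2 * e + 1 \<in> \<alpha> \<and> 2 * e + 2 \<in> \<alpha>) \<and> \<not> (2 * e + 2 \<in> \<alpha> \<and> 2 * nxt N e + 1 \<in> \<alpha>))" (is "_ \<longleftrightarrow> ?R")
proof
  assume s: "stable (2 * N) \<alpha>"
  have c: "\<not> (p \<in> \<alpha> \<and> p + 1 \<in> \<alpha>)" if "1 \<le> p" "p < 2 * N" for p
    using s that unfolding stable_def by blast
  have "\<not> (2 * e + 1 \<in> \<alpha> \<and> 2 * e + 2 \<in> \<alpha>)" if "e < N" for e
    using c[of "2 * e + 1"] that by simp
  moreover have "\<not> (2 * e + 2 \<in> \<alpha> \<and> 2 * nxt N e + 1 \<in> \<alpha>)" if "e < N" for e
  proof (cases "Suc e = N")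
    case True
    then have "2 * e + 2 = 2 * N" "2 * nxt N e + 1 = 1" by (auto simp: nxt_def)
    then show ?thesis using s unfolding stable_def by auto
  next
    case False
    then show ?thesis using c[of "2 * e + 2"] that by (simp add: nxt_cases)
  qed
  ultimately show ?R using s by (simp add: stable_def)
next
  assume R: ?R
  have "\<not> {i, i + 1} \<subseteq> \<alpha>" if i: "1 \<le> i \<and> i < 2 * N" for i
  proof -
    have "i \<in> {1..2 * N}" using i by simp
    then obtain e where e: "e < N" "i = 2 * e + 1 \<or> i = 2 * e + 2" by (rule pair_cases)
    show ?thesis
    proof (cases "i = 2 * e + 1")
      case False
      then have "Suc e < N" "i = 2 * e + 2" using e i by auto
      then have "i + 1 = 2 * nxt N e + 1" by (simp add: nxt_cases)
      then show ?thesis using R e \<open>i = 2 * e + 2\<close> by auto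
    qed (use R e in auto)
  qed
  moreover have "\<not> {1, 2 * N} \<subseteq> \<alpha>"
  proof -
    have "2 * (N - 1) + 2 = 2 * N" "2 * nxt N (N - 1) + 1 = 1" "N - 1 < N" 
      using assms by (auto simp: nxt_def)
    then show ?thesis using R by (metis insert_subset)
  qed
  ultimately show "stable (2 * N) \<alpha>" using R by (simp add: stable_def)
qed

lemma stable_stable_of:
  assumes "r < N" "x < N"
  shows "stable (2 * N) (stable_of N (r, x))" "card (stable_of N (r, x)) = N - 1"
proof -
  show "stable (2 * N) (stable_of N (r, x))"
    using assms offs_nxt[of x N] stable_of_subset[of N "(r, x)"]
    by (subst stable_iff) (auto simp only: mem_stable_of split: if_splits)
  define f where "f e = (if offs N x e \<le> r then 2 * e + 1 else 2 * e + 2)" for e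
  have "stable_of N (r, x) = f ` ({..<N} - {x})"
    using offs_eq_0[OF assms(2)] by (auto simp: stable_of_def f_def Suc_le_eq image_iff)
  moreover have "inj_on f ({..<N} - {x})"
    by (rule inj_on_inverseI[of _ "\<lambda>p. (p - 1) div 2"]) (simp add: f_def)
  ultimately show "card (stable_of N (r, x)) = N - 1"
    using assms(2) by (simp add: card_image)
qed

text \<open>The missed pair recovers \<open>x\<close>, and the last odd letter after it recovers
  \<open>r\<close>.\<close>

lemma inj_on_stable_of: "inj_on (stable_of N) ({..<N} \<times> {..<N})"
proof (rule inj_onI)
  fix p p' assume p: "p \<in> {..<N} \<times> {..<N}" "p' \<in> {..<N} \<times> {..<N}" and eq: "stable_of N p = stable_of N p'"
  obtain r x r' x' where px: "p = (r, x)" "p' = (r', x')" by (cases p, cases p')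
  have b: "r < N" "x < N" "r' < N" "x' < N" using p px by auto
  have eq': "stable_of N (r, x) = stable_of N (r', x')" using eq px by simp
  have "2 * x + 1 \<notin> stable_of N (r, x)" "2 * x + 2 \<notin> stable_of N (r, x)"
    unfolding mem_stable_of by simp_all
  then have "offs N x' x = 0" unfolding eq' mem_stable_of using b by auto
  then have "x = x'" using offs_eq_0 b by simp
  have less: "\<not> s < s'" if "stable_of N (s, x) = stable_of N (s', x)" "s' < N" for s s'
  proof
    assume "s < s'"
    define e where "e = (x + s') mod N"
    have e: "e < N" "offs N x e = s'" using offs_add[of x N s'] b that(2) by (auto simp: e_def)
    have "2 * e + 1 \<in> stable_of N (s', x)" "2 * e + 1 \<notin> stable_of N (s, x)"
      unfolding mem_stable_of using e \<open>s < s'\<close> by auto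
    then show False using that(1) by simp
  qed
  have "r = r'"
    using less[of r r'] less[of r' r] eq' b \<open>x = x'\<close> by (metis nat_neq_iff)
  then show "p = p'" using px \<open>x = x'\<close> by simp
qed

text \<open>With at most one letter per pair, \<open>N - 1\<close> letters leave exactly one of the
  \<open>N\<close> pairs empty. Going round from there, stability forbids an odd letter right after
  an even one, so the odd letters form an initial run, whose length is \<open>r\<close>.\<close>

lemma stable_of_surj:
  assumes N: "1 \<le> N" and \<alpha>: "stable (2 * N) \<alpha>" "card \<alpha> = N - 1"
  shows "\<alpha> \<in> stable_of N ` ({..<N} \<times> {..<N})"
proof -
  have sub: "\<alpha> \<subseteq> {1..2 * N}" 
    and s1: "\<And>e. e < N \<Longrightarrow> \<not> (2 * e + 1 \<in> \<alpha> \<and> 2 * e + 2 \<in> \<alpha>)"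
    and s2: "\<And>e. e < N \<Longrightarrow> \<not> (2 * e + 2 \<in> \<alpha> \<and> 2 * nxt N e + 1 \<in> \<alpha>)"
    using \<alpha>(1) stable_iff[OF N] by auto
  define E where "E = {e. e < N \<and> (2 * e + 1 \<in> \<alpha> \<or> 2 * e + 2 \<in> \<alpha>)}"
  define f where "f e = (if 2 * e + 1 \<in> \<alpha> then 2 * e + 1 else 2 * e + 2)" for e
  have "\<alpha> = f ` E"
  proof
    show "\<alpha> \<subseteq> f ` E"
    proof
      fix p assume p: "p \<in> \<alpha>"
      then have "p \<in> {1..2 * N}" using sub by blast
      then obtain e where e: "e < N" "p = 2 * e + 1 \<or> p = 2 * e + 2" by (rule pair_cases)
      then have "p = f e" "e \<in> E" using p s1[of e] by (auto simp: f_def E_def)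
      then show "p \<in> f ` E" by blast
    qed
  qed (auto simp: f_def E_def)
  moreover have "inj_on f E"
    by (rule inj_on_inverseI[of _ "\<lambda>p. (p - 1) div 2"]) (simp add: f_def)
  ultimately have "card E = N - 1" using \<alpha>(2) by (simp add: card_image)
  moreover have "E \<subseteq> {..<N}" by (auto simp: E_def)
  ultimately have "card ({..<N} - E) = 1" using N by (simp add: card_Diff_subset finite_subset)
  then obtain x where x: "{..<N} - E = {x}" by (auto simp: card_1_singleton_iff)
  then have "x < N" and xE: "\<And>e. e < N \<Longrightarrow> e \<in> E \<longleftrightarrow> e \<noteq> x" by auto
  define c where "c j = (x + j) mod N" for j
  have cN: "c j < N" for j using N by (simp add: c_def)
  have c_nxt: "c (Suc j) = nxt N (c j)" for j
    by (simp add: c_def nxt_def mod_Suc_eq)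
  have cE: "c j \<in> E" if "1 \<le> j" "j < N" for j
    using xE[OF cN] offs_add[OF \<open>x < N\<close> that(2)] offs_eq_0[OF \<open>x < N\<close> cN, of j] that by (auto simp: c_def)
  \<comment> \<open>The run of odd letters can be extended only while it fills all pairs so far,
    that is, while \<open>r = m\<close>.\<close>
  have "\<exists>r\<le>m. \<forall>j. 1 \<le> j \<and> j \<le> m \<longrightarrow> (j \<le> r \<longrightarrow> 2 * c j + 1 \<in> \<alpha>) \<and> (r < j \<longrightarrow> 2 * c j + 2 \<in> \<alpha>)"
    if "m < N" for m
    using that
  proof (induction m)
    case (Suc m)
    then obtain r where r: "r \<le> m" "\<And>j. 1 \<le> j \<Longrightarrow> j \<le> m \<Longrightarrow> (j \<le> r \<longrightarrow> 2 * c j + 1 \<in> \<alpha>) \<and> (r < j \<longrightarrow> 2 * c j + 2 \<in> \<alpha>)"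
      by auto
    show ?case
    proof (cases "2 * c (Suc m) + 1 \<in> \<alpha>")
      case True
      have "r = m"
      proof (rule ccontr)
        assume "r \<noteq> m"
        then have "2 * c m + 2 \<in> \<alpha>" using r(1) r(2)[of m] by simp
        then show False using s2[OF cN, of m] True by (simp add: c_nxt)
      qed
      then show ?thesis using r(2) True by (intro exI[of _ "Suc m"]) (auto simp: le_Suc_eq)
    next
      case False
      then have "2 * c (Suc m) + 2 \<in> \<alpha>" using cE[of "Suc m"] Suc.prems by (auto simp: E_def)
      then show ?thesis using r by (intro exI[of _ r]) (auto simp: le_Suc_eq)
    qed
  qed simp
  from this[of "N - 1"] N obtain r where r: "r \<le> N - 1"
    "\<And>j. 1 \<le> j \<Longrightarrow> j \<le> N - 1 \<Longrightarrow> (j \<le> r \<longrightarrow> 2 * c j + 1 \<in> \<alpha>) \<and> (r < j \<longrightarrow> 2 * c j + 2 \<in> \<alpha>)"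
    by auto
  have ce: "c (offs N x e) = e" if "e < N" for e
    using add_offs[OF \<open>x < N\<close> that] by (simp add: c_def)
  have re: "(offs N x e \<le> r \<longrightarrow> 2 * e + 1 \<in> \<alpha>) \<and> (r < offs N x e \<longrightarrow> 2 * e + 2 \<in> \<alpha>)" if "e < N" "e \<noteq> x" for e
    using r(2)[of "offs N x e"] ce[OF that(1)] offs_less[OF \<open>x < N\<close> that(1)] offs_eq_0[OF \<open>x < N\<close> that(1)] that(2)
    by auto
  have "p \<in> \<alpha> \<longleftrightarrow> p \<in> stable_of N (r, x)" if p: "p \<in> {1..2 * N}" for p
  proof -
    obtain e where e: "e < N" "p = 2 * e + 1 \<or> p = 2 * e + 2" using p by (rule pair_cases)
    show ?thesis
    proof (cases "e = x")
      case True
      then have "p \<notin> \<alpha>" using xE[OF e(1)] e by (auto simp: E_def)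
      moreover have "p \<notin> stable_of N (r, x)"
        using e(2) offs_eq_0[OF \<open>x < N\<close> e(1)] True mem_stable_of by auto
      ultimately show ?thesis by simp
    next
      case False
      then have "0 < offs N x e" using offs_eq_0[OF \<open>x < N\<close> e(1)] by simp
      then show ?thesis
        using e re[OF e(1) False] s1[OF e(1)] mem_stable_of[of e N r x] by (cases "offs N x e \<le> r") auto
    qed
  qed
  then have "\<alpha> = stable_of N (r, x)" using sub stable_of_subset[of N "(r, x)"] by blast
  then show ?thesis using r(1) N \<open>x < N\<close> by auto
qed

section \<open>Neighborhoods of stable sets as facets\<close>

lemma disjoint_iff_letters:
  "stable_of N (t, k) \<inter> stable_of N (s, y) = {} \<longleftrightarrow>
     (\<forall>e<N. \<not> (1 \<le> offs N k e \<and> offs N k e \<le> t \<and> 1 \<le> offs N y e \<and> offs N y e \<le> s) \<and>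
            \<not> (t < offs N k e \<and> s < offs N y e))" (is "?L \<longleftrightarrow> ?R")
proof
  assume L: ?L
  show ?R
  proof (intro allI impI)
    fix e assume "e < N"
    moreover have "2 * e + 1 \<notin> stable_of N (t, k) \<inter> stable_of N (s, y)"
      "2 * e + 2 \<notin> stable_of N (t, k) \<inter> stable_of N (s, y)" using L by simp_all
    ultimately show "\<not> (1 \<le> offs N k e \<and> offs N k e \<le> t \<and> 1 \<le> offs N y e \<and> offs N y e \<le> s) \<and>
            \<not> (t < offs N k e \<and> s < offs N y e)"
      unfolding Int_iff mem_stable_of by blast
  qed
next
  assume R: ?R
  have "p \<notin> stable_of N (t, k) \<inter> stable_of N (s, y)" if "p \<in> {1..2 * N}" for p
  proof -
    obtain e where e: "e < N" "p = 2 * e + 1 \<or> p = 2 * e + 2" using \<open>p \<in> _\<close> by (rule pair_cases)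
    then show ?thesis using R mem_stable_of[of e N t k] mem_stable_of[of e N s y] by auto
  qed
  then show ?L using stable_of_subset[of N "(t, k)"] by blast
qed

text \<open>This is disjointness for \<open>i = 0\<close>, written out in letters: the common
  neighbour has even letters at the pairs from 1 to \<open>r\<close>, none at pair
  \<open>r + 1\<close> modulo \<open>N\<close>, and odd letters at all others.\<close>

lemma facet_0_iff:
  assumes N: "2 \<le> N" and "r < N" "t < N" "k < N"
  shows "(\<forall>j<N. (Suc r < j \<or> j = 0 \<and> Suc r < N \<longrightarrow> \<not> (1 \<le> offs N k j \<and> offs N k j \<le> t)) \<and>
           (1 \<le> j \<and> j \<le> r \<longrightarrow> \<not> t < offs N k j)) \<longleftrightarrow> (t, k) \<in> facet N r 0" (is "?L \<longleftrightarrow> _")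
proof
  assume L: ?L
  have A: "\<not> (1 \<le> offs N k j \<and> offs N k j \<le> t)" if "j < N" "Suc r < j \<or> j = 0 \<and> Suc r < N" for j
    using L that by blast
  have B: "offs N k j \<le> t" if "1 \<le> j" "j \<le> r" for j
    using L that assms(2) by (meson leI le_less_trans)
  have n1: "nxt N 0 = 1" using N by (simp add: nxt_def)
  consider (bottom) "r = 0" | (mid) "0 < r" "Suc r < N" | (top) "0 < r" "Suc r = N"
    using assms(2) by linarith
  then show "(t, k) \<in> facet N r 0"
  proof cases
    case bottom
    show ?thesis
    proof (cases "k = 0")
      case True
      then have "t < 2" using A[of 2] assms bottom N by (cases "N = 2") (auto simp: offs_def)
      then show ?thesis using True bottom N by (auto simp: mem_facet less_2_cases_iff)
    next
      case False
      then have "t = 0"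
        using A[of "Suc k"] A[of 0] bottom N assms(4) 
        by (cases "Suc k = N") (auto simp: offs_def split: if_splits)
      then show ?thesis using bottom assms by (simp add: mem_facet)
    qed
  next
    case mid
    consider "k = 0" | "k = 1" | "2 \<le> k" by linarith
    then show ?thesis
    proof cases
      case 1
      then have "r \<le> t" using B[of r] mid by (simp add: offs_def)
      moreover have "t < Suc (Suc r)"
        using A[of "Suc (Suc r)"] 1 assms(3) mid by (cases "Suc (Suc r) = N") (auto simp: offs_def)
      ultimately show ?thesis using 1 mid by (auto simp: mem_facet)
    next
      case 2
      then have "r - 1 \<le> t" using B[of r] mid by (simp add: offs_def)
      moreover have "t < N - 1" using A[of 0] 2 mid by (auto simp: offs_def)
      then have "t < Suc r"
        using A[of "Suc (Suc r)"] 2 mid by (cases "Suc (Suc r) = N") (auto simp: offs_def)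
      ultimately show ?thesis using 2 mid n1 by (auto simp: mem_facet)
    next
      \<comment> \<open>Counted from \<open>k \<ge> 2\<close>, pair 0 comes directly before pair 1.
        Avoiding the even letter at pair 1 means an odd letter there, hence also one at pair 0,
        where it is excluded.\<close>
      case 3
      then show ?thesis using B[of 1] A[of 0] mid assms(4) by (auto simp: offs_def)
    qed
  next
    case top
    consider "k = 0" | "k = 1" | "2 \<le> k" by linarith
    then show ?thesis
    proof cases
      case 1
      then show ?thesis using B[of r] top assms(3) by (auto simp: mem_facet offs_def)
    next
      case 2
      then have "r - 1 \<le> t" using B[of r] top by (simp add: offs_def)
      then show ?thesis using 2 top assms(3) n1 by (auto simp: mem_facet)
    next
      case 3
      then have "offs N k (k - 1) = N - 1" using assms(4) by (simp add: offs_def)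
      then have "N - 1 \<le> t" using B[of "k - 1"] 3 top assms(4) by simp
      then show ?thesis using top assms by (auto simp: mem_facet)
    qed
  qed
next
  assume F: "(t, k) \<in> facet N r 0"
  have n1: "nxt N 0 = 1" using N by (simp add: nxt_def)
  from F consider "t = r" "k = 0" | "t = r" "k = 1" | "t = Suc r" "Suc r < N" "k = 0" | "r = Suc t" "k = 1"
    | "t = r" "r = 0" | "t = r" "Suc r = N"
    unfolding mem_facet n1 by blast
  then show ?L
    by cases (use assms in \<open>auto simp: offs_def\<close>)
qed

lemma facet_rotate:
  assumes N: "2 \<le> N" and "r < N" "i < N" "k < N"
  shows "(t, k) \<in> facet N r i \<longleftrightarrow> (t, offs N i k) \<in> facet N r 0"
proof -
  have "k = i \<longleftrightarrow> offs N i k = 0" using offs_eq_0 assms by simp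
  moreover have "k = nxt N i \<longleftrightarrow> offs N i k = nxt N 0"
  proof -
    have "offs N i (nxt N i) = nxt N 0"
      using offs_nxt[OF assms(3,3)] N by (simp add: nxt_cases)
    moreover have "k = nxt N i" if "offs N i k = offs N i (nxt N i)"
    proof -
      have "nxt N i < N" using nxt_less N by simp
      have "k = (i + offs N i k) mod N" by (rule add_offs[OF assms(3,4), symmetric])
      also have "\<dots> = nxt N i" unfolding that by (rule add_offs[OF assms(3) \<open>nxt N i < N\<close>])
      finally show ?thesis .
    qed
    ultimately show ?thesis by auto
  qed
  moreover have "offs N i k < N" using offs_less assms by simp
  ultimately show ?thesis using assms(4) by (simp add: mem_facet)
qed

text \<open>The common neighbour of a facet lies in the mirrored row, and its missed pair comes
  \<open>r + 1\<close> steps after \<open>i\<close>. Counting positions from \<open>i\<close>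
  reduces the claim to \<open>facet_0_iff\<close>.\<close>

lemma disjoint_iff_facet:
  assumes N: "2 \<le> N" and r: "r < N" and i: "i < N" and t: "t < N" and k: "k < N"
  shows "stable_of N (t, k) \<inter> stable_of N (N - Suc r, (i + Suc r) mod N) = {} \<longleftrightarrow> (t, k) \<in> facet N r i"
proof -
  define y where "y = (i + Suc r) mod N"
  \<comment> \<open>The position of \<open>y\<close> counted from \<open>i\<close>; in the last row
    \<open>i + N\<close> wraps around to \<open>i\<close> itself.\<close>
  define y' where "y' = (if Suc r < N then Suc r else 0)"
  define P where "P j \<longleftrightarrow> (Suc r < j \<or> j = 0 \<and> Suc r < N \<longrightarrow> 
      \<not> (1 \<le> offs N (offs N i k) j \<and> offs N (offs N i k) j \<le> t)) \<and>
      (1 \<le> j \<and> j \<le> r \<longrightarrow> \<not> t < offs N (offs N i k) j)" for j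
  have "y < N" using N by (simp add: y_def)
  have "offs N i y = y'"
  proof (cases "Suc r < N")
    case True
    then show ?thesis using offs_add[OF i True] by (simp add: y_def y'_def)
  next
    case False
    then have "Suc r = N" using r by simp
    then have "y = i" using i by (simp add: y_def)
    then show ?thesis using False by (simp add: y'_def)
  qed
  have letters: "\<not> (1 \<le> offs N k e \<and> offs N k e \<le> t \<and> 1 \<le> offs N y e \<and> offs N y e \<le> N - Suc r) \<and>
            \<not> (t < offs N k e \<and> N - Suc r < offs N y e) \<longleftrightarrow> P (offs N i e)" if e: "e < N" for e
  proof -
    define j where "j = offs N i e"
    have "j < N" using offs_less[OF i e] by (simp add: j_def)
    have ky: "offs N k e = offs N (offs N i k) j" "offs N y e = offs N y' j"
      using offs_offs[OF i k e] offs_offs[OF i \<open>y < N\<close> e] \<open>offs N i y = y'\<close> by (simp_all add: j_def)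
    have "1 \<le> offs N y' j \<and> offs N y' j \<le> N - Suc r \<longleftrightarrow> Suc r < j \<or> j = 0 \<and> Suc r < N"
      "N - Suc r < offs N y' j \<longleftrightarrow> 1 \<le> j \<and> j \<le> r"
      using \<open>j < N\<close> r by (auto simp: offs_def y'_def)
    then show ?thesis unfolding ky P_def j_def[symmetric] by blast
  qed
  have "stable_of N (t, k) \<inter> stable_of N (N - Suc r, y) = {} \<longleftrightarrow> (\<forall>e<N. P (offs N i e))"
    unfolding disjoint_iff_letters using letters by simp
  also have "\<dots> \<longleftrightarrow> (\<forall>j<N. P j)"
  proof
    assume *: "\<forall>e<N. P (offs N i e)"
    show "\<forall>j<N. P j"
    proof (intro allI impI)
      fix j assume "j < N"
      then show "P j" using *[rule_format, of "(i + j) mod N"] offs_add[OF i \<open>j < N\<close>] by simp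
    qed
  qed (use offs_less[OF i] in blast)
  also have "\<dots> \<longleftrightarrow> (t, offs N i k) \<in> facet N r 0"
    unfolding P_def by (rule facet_0_iff[OF N r t offs_less[OF i k]])
  also have "\<dots> \<longleftrightarrow> (t, k) \<in> facet N r i"
    using facet_rotate[OF N r i k] by simp
  finally show ?thesis by (simp add: y_def)
qed

lemma stable_vertices:
  assumes "1 \<le> n"
  shows "{\<alpha>. stable (2 * n + 2) \<alpha> \<and> card \<alpha> = n} = stable_of (Suc n) ` ({..<Suc n} \<times> {..<Suc n})"
proof -
  have "2 * n + 2 = 2 * Suc n" "n = Suc n - 1" by simp_all
  then show ?thesis
    using stable_of_surj[of "Suc n"] stable_stable_of[of _ "Suc n"] by auto
qed

lemma neighborhood_complex_stable_kneser:
  assumes "1 \<le> n"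
  shows "neighborhood_complex (stable_kneser_graph n 2) = (`) (stable_of (Suc n)) ` facet_complex (Suc n)"
proof -
  define N where "N = Suc n"
  have N: "2 \<le> N" using assms by (simp add: N_def)
  define G where "G = {..<N} \<times> {..<N}"
  define V where "V = stable_of N ` G"
  have "stable_kneser_graph n 2 = \<lparr>pverts = V, parcs = {(\<alpha>, \<beta>). \<alpha> \<in> V \<and> \<beta> \<in> V \<and> \<alpha> \<inter> \<beta> = {}}\<rparr>"
    unfolding stable_kneser_graph_def stable_vertices[OF assms] V_def G_def N_def Let_def ..
  then have "neighborhood_complex (stable_kneser_graph n 2) =
      {F. F \<subseteq> V \<and> (\<exists>v\<in>V. \<forall>u\<in>F. u \<in> V \<and> v \<in> V \<and> u \<inter> v = {})}"
    by (simp add: neighborhood_complex_def)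
  also have "\<dots> = {F. F \<subseteq> V \<and> (\<exists>v\<in>V. \<forall>u\<in>F. u \<inter> v = {})}"
    by (intro Collect_cong conj_cong bex_cong ball_cong refl) (simp add: subsetD)
  also have "\<dots> = (`) (stable_of N) ` facet_complex N"
  proof (intro set_eqI iffI)
    fix F assume F: "F \<in> {F. F \<subseteq> V \<and> (\<exists>v\<in>V. \<forall>u\<in>F. u \<inter> v = {})}"
    then obtain s y where sy: "s < N" "y < N" "\<forall>u\<in>F. u \<inter> stable_of N (s, y) = {}"
      by (auto simp: V_def G_def)
    obtain F' where F': "F' \<subseteq> G" "F = stable_of N ` F'"
      using F by (auto simp: V_def subset_image_iff)
    \<comment> \<open>Inverse of the passage from \<open>(r, i)\<close> to the common neighbour:
      since \<open>s + Suc r = N\<close>, adding \<open>Suc r\<close> to \<open>i\<close> completes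
      one turn of the cycle and returns to \<open>y\<close>.\<close>
    define r where "r = N - Suc s"
    define i where "i = (y + s) mod N"
    have r: "r < N" "N - Suc r = s" using sy by (auto simp: r_def)
    have "i < N" using N by (simp add: i_def)
    have "(i + Suc r) mod N = (y + (s + Suc r)) mod N"
      unfolding i_def mod_add_left_eq by (simp only: add.assoc)
    also have "s + Suc r = N" using sy by (simp add: r_def)
    finally have y: "(i + Suc r) mod N = y" using sy by simp
    have "F' \<subseteq> facet N r i"
    proof
      fix x assume x: "x \<in> F'"
      obtain t k where tk: "x = (t, k)" by (cases x)
      then have "t < N" "k < N" using x F'(1) by (auto simp: G_def)
      moreover have "stable_of N (t, k) \<inter> stable_of N (s, y) = {}" using sy(3) F'(2) x tk by simp
      ultimately show "x \<in> facet N r i"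
        using disjoint_iff_facet[OF N r(1) \<open>i < N\<close>, of t k] r(2) y tk by simp
    qed
    then have "F' \<in> facet_complex N" using r(1) \<open>i < N\<close> by (auto simp: facet_complex_def)
    then show "F \<in> (`) (stable_of N) ` facet_complex N" using F'(2) by blast
  next
    fix F assume "F \<in> (`) (stable_of N) ` facet_complex N"
    then obtain F' r i where F': "F = stable_of N ` F'" "r < N" "i < N" "F' \<subseteq> facet N r i"
      by (auto simp: facet_complex_def)
    have sub: "F' \<subseteq> G" using F' facet_subset unfolding G_def by blast
    have v: "(N - Suc r, (i + Suc r) mod N) \<in> G" using N by (simp add: G_def)
    have "u \<inter> stable_of N (N - Suc r, (i + Suc r) mod N) = {}" if u: "u \<in> F" for u
    proof -
      obtain x where x: "x \<in> F'" "u = stable_of N x" using u unfolding F'(1) by (rule imageE)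
      obtain t k where tk: "x = (t, k)" by (cases x)
      then have "t < N" "k < N" using x(1) sub by (auto simp: G_def)
      then show ?thesis
        using disjoint_iff_facet[OF N F'(2,3), of t k] subsetD[OF F'(4) x(1)] x(2) tk by simp
    qed
    moreover have "stable_of N (N - Suc r, (i + Suc r) mod N) \<in> V" "F \<subseteq> V"
      using v sub F'(1) unfolding V_def by auto
    ultimately show "F \<in> {F. F \<subseteq> V \<and> (\<exists>v\<in>V. \<forall>u\<in>F. u \<inter> v = {})}"
      by (intro CollectI conjI bexI ballI)
  qed
  finally show ?thesis by (simp add: N_def)
qed

theorem theorem1p2:
  fixes n :: nat
  assumes "n \<ge> 1"
  shows "\<exists>L. collapses_onto (neighborhood_complex (stable_kneser_graph n 2)) L \<and>
           (\<exists>P :: (real ^ 3) set. simplicial_polytope P \<and> aff_dim P = 3 \<and>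
              complex_iso L (boundary_complex P))"
proof -
  define N where "N = Suc n"
  have N: "2 \<le> N" using assms by (simp add: N_def)
  define S where "S = {F. \<exists>t\<in>tower N. F \<subseteq> t}"
  have US: "\<Union>S = \<Union>(tower N)" by (auto simp: S_def)
  have "\<Union>(facet_complex N) \<subseteq> {..<N} \<times> {..<N}"
    unfolding facet_complex_def using facet_subset by blast
  then have inj1: "inj_on (stable_of N) (\<Union>(facet_complex N))"
    by (rule inj_on_subset[OF inj_on_stable_of])
  have "\<Union>(tower N) \<subseteq> {..<N} \<times> {..<N}" using tower_subset by blast
  then have inj2: "inj_on (stable_of N) (\<Union>S)"
    unfolding US by (rule inj_on_subset[OF inj_on_stable_of])
  obtain q :: "nat \<times> nat \<Rightarrow> real ^ 3" and P where P: "inj_on q (\<Union>S)" "simplicial_polytope P"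
    "aff_dim P = 3" "boundary_complex P = (`) q ` S"
    using tower_realizable[OF N] unfolding US[symmetric] S_def[symmetric] by (elim exE conjE)
  have "collapses_onto (neighborhood_complex (stable_kneser_graph n 2)) ((`) (stable_of N) ` S)"
    using collapses_onto_image[OF facet_complex_collapses[OF N] inj1]
      neighborhood_complex_stable_kneser[OF assms] by (simp add: N_def S_def)
  moreover have "complex_iso ((`) (stable_of N) ` S) (boundary_complex P)"
    unfolding P(4) by (rule complex_iso_images[OF inj2 P(1)])
  ultimately show ?thesis using P(2,3) by (intro exI conjI)
qed

end
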